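(* Let $T$ be a (connected) abelian Lie group with Lie algebra $\mathfrak t$, acting nontrivially by triholomorphic isometries on a connected hyper-Kähler manifold $M$ with zero first Betti number, with $\dim M=4\dim T\ge 8$ (real dimensions). Let $\phi:M\to(\mathfrak t\otimes\mathrm{Im}\,\mathbb H)^*$ be the hyper-Kähler moment map. If $\phi$ is horizontally weakly conformal, with respect to some Euclidean metric on $\mathfrak t$, then $M$ is flat.
   Context: Let $(g,J_1,J_2,J_3)$ be the hyper-Kähler structure of $M$ ($J_1J_2=J_3=-J_2J_1$), and for $q=(q^1,q^2,q^3)\in S^2\subseteq\mathrm{Im}\,\mathbb H=\mathbb R^3$ put $J_q=\sum_j q^jJ_j$, with Kähler form $\omega_q(X,Y)=g(J_qX,Y)$. An isometry is triholomorphic if it is holomorphic with respect to $J_1,J_2,J_3$. The hyper-Kähler moment map $\phi:M\to(\mathfrak t\otimes\mathrm{Im}\,\mathbb H)^*$ is characterised by the following: for any $v\in\mathfrak t$ and unit $q\in\mathrm{Im}\,\mathbb H$, the function $x\mapsto\phi(x)(v\otimes q)$ is the Hamiltonian, with respect to $\omega_q$, of the fundamental vector field $V$ on $M$ corresponding to $v$ (i.e. its differential is $\omega_q(V,\cdot)$, up to a global sign convention). A smooth map $\phi:(M,g)\to(N,h)$ between Riemannian manifolds is horizontally weakly conformal if at each $x\in M$ either $d\phi_x=0$, or $d\phi_x$ restricted to $(\ker d\phi_x)^\perp$ is a conformal linear isomorphism onto $T_{\phi(x)}N$. "With respect to some Euclidean metric on $\mathfrak t$" means that $(\mathfrak t\otimes\mathrm{Im}\,\mathbb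 H)^*$ carries the Euclidean metric induced by the one on $\mathfrak t$ and the canonical one on $\mathrm{Im}\,\mathbb H$. An action is nontrivial if it has at least one orbit that is not a fixed point. *)

theory Defs
  imports "HOL-Analysis.Analysis" "HOL-Homology.Homology" "HOL-Library.Extended_Nat"
begin

section \<open>Smooth manifolds\<close>

text \<open>All domains occurring below are open subsets of finite-dimensional spaces, where demanding
  that every iterated directional derivative exists and is differentiable is the usual notion of
  smoothness.\<close>

primrec C_k_on :: "nat \<Rightarrow> 'a::real_normed_vector set \<Rightarrow> ('a \<Rightarrow> 'b::real_normed_vector) \<Rightarrow> bool" where
  "C_k_on 0 S f \<longleftrightarrow> continuous_on S f"
| "C_k_on (Suc k) S f \<longleftrightarrow> (\<forall>x\<in>S. f differentiable (at x)) \<and>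
     (\<forall>v. C_k_on k S (\<lambda>x. frechet_derivative f (at x) v))"

definition smooth_on :: "'a::real_normed_vector set \<Rightarrow> ('a \<Rightarrow> 'b::real_normed_vector) \<Rightarrow> bool" where
  "smooth_on S f \<longleftrightarrow> (\<forall>k. C_k_on k S f)"

text \<open>A chart is a pair of its domain and its coordinate map; values of the coordinate map
  outside the domain are irrelevant.\<close>

type_synonym ('m, 'e) chart = "'m set \<times> ('m \<Rightarrow> 'e)"

definition chart_image :: "('m, 'e) chart \<Rightarrow> 'e set" where
  "chart_image c = snd c ` fst c"

definition chart_inv :: "('m, 'e) chart \<Rightarrow> 'e \<Rightarrow> 'm" where
  "chart_inv c = inv_into (fst c) (snd c)"

text \<open>The manifold is the whole type \<open>'m\<close>, its dimension is \<open>DIM('e)\<close>.\<close>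

locale smooth_manifold =
  fixes A :: "('m::{t2_space, second_countable_topology}, 'e::euclidean_space) chart set"
  assumes covering: "(\<Union>c\<in>A. fst c) = UNIV"
    and open_domain: "c \<in> A \<Longrightarrow> open (fst c)"
    and open_image: "c \<in> A \<Longrightarrow> open (chart_image c)"
    and chart_homeomorphism: "c \<in> A \<Longrightarrow> homeomorphism (fst c) (chart_image c) (snd c) (chart_inv c)"
    and smooth_transition:
      "c \<in> A \<Longrightarrow> d \<in> A \<Longrightarrow> smooth_on (snd c ` (fst c \<inter> fst d)) (snd d \<circ> chart_inv c)"

definition prod_atlas ::
    "('m, 'e) chart set \<Rightarrow> ('n, 'f) chart set \<Rightarrow> ('m \<times> 'n, 'e \<times> 'f) chart set" where
  "prod_atlas A B = {(fst c \<times> fst d, map_prod (snd c) (snd d)) |c d. c \<in> A \<and> d \<in> B}"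

definition vector_space_atlas :: "('v::real_normed_vector, 'v) chart set" where
  "vector_space_atlas = {(UNIV, id)}"

definition smooth_map ::
    "('m::topological_space, 'e::real_normed_vector) chart set \<Rightarrow>
     ('n::topological_space, 'f::real_normed_vector) chart set \<Rightarrow> ('m \<Rightarrow> 'n) \<Rightarrow> bool" where
  "smooth_map A B f \<longleftrightarrow> continuous_on UNIV f \<and>
     (\<forall>c\<in>A. \<forall>d\<in>B. smooth_on (snd c ` (fst c \<inter> f -` fst d)) (snd d \<circ> f \<circ> chart_inv c))"


section \<open>Tangent spaces and tensor fields\<close>

text \<open>For each point \<open>x\<close> a chart around \<open>x\<close> is selected once and for all, and the tangent space at
  \<open>x\<close> is identified with the model space \<open>'e\<close> through that chart. Nothing is assumed
  about how the selection depends on \<open>x\<close>: smoothness of tensor fields is always tested on their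
  coefficients in the charts of the atlas. For \<open>vector_space_atlas\<close> this identification is the
  canonical one.\<close>

definition chart_at :: "('m, 'e) chart set \<Rightarrow> 'm \<Rightarrow> ('m, 'e) chart" where
  "chart_at A x = (SOME c. c \<in> A \<and> x \<in> fst c)"

definition differential ::
    "('m, 'e::real_normed_vector) chart set \<Rightarrow> ('n, 'f::real_normed_vector) chart set \<Rightarrow>
     ('m \<Rightarrow> 'n) \<Rightarrow> 'm \<Rightarrow> 'e \<Rightarrow> 'f" where
  "differential A B f x =
     frechet_derivative (snd (chart_at B (f x)) \<circ> f \<circ> chart_inv (chart_at A x))
       (at (snd (chart_at A x) x))"

text \<open>The two mutually inverse identifications between the tangent space at \<open>x\<close> and the
  coordinate vectors of a chart \<open>c\<close> around \<open>x\<close>.\<close>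

definition from_coords ::
    "('m, 'e::real_normed_vector) chart set \<Rightarrow> ('m, 'e) chart \<Rightarrow> 'm \<Rightarrow> 'e \<Rightarrow> 'e" where
  "from_coords A c x = frechet_derivative (snd (chart_at A x) \<circ> chart_inv c) (at (snd c x))"

definition to_coords ::
    "('m, 'e::real_normed_vector) chart set \<Rightarrow> ('m, 'e) chart \<Rightarrow> 'm \<Rightarrow> 'e \<Rightarrow> 'e" where
  "to_coords A c x =
     frechet_derivative (snd c \<circ> chart_inv (chart_at A x)) (at (snd (chart_at A x) x))"

definition form_in_chart ::
    "('m, 'e::real_normed_vector) chart set \<Rightarrow> ('m \<Rightarrow> 'e \<Rightarrow> 'e \<Rightarrow> real) \<Rightarrow>
     ('m, 'e) chart \<Rightarrow> 'e \<Rightarrow> 'e \<Rightarrow> 'e \<Rightarrow> real" where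
  "form_in_chart A g c y u v =
     (let x = chart_inv c y in g x (from_coords A c x u) (from_coords A c x v))"

definition endo_in_chart ::
    "('m, 'e::real_normed_vector) chart set \<Rightarrow> ('m \<Rightarrow> 'e \<Rightarrow> 'e) \<Rightarrow>
     ('m, 'e) chart \<Rightarrow> 'e \<Rightarrow> 'e \<Rightarrow> 'e" where
  "endo_in_chart A J c y u =
     (let x = chart_inv c y in to_coords A c x (J x (from_coords A c x u)))"


section \<open>Riemannian and hyper-Kaehler manifolds\<close>

definition inner_product :: "('v::real_vector \<Rightarrow> 'v \<Rightarrow> real) \<Rightarrow> bool" where
  "inner_product b \<longleftrightarrow> bilinear b \<and> (\<forall>u v. b u v = b v u) \<and> (\<forall>u. u \<noteq> 0 \<longrightarrow> b u u > 0)"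

locale riemannian_manifold = smooth_manifold A
  for A :: "('m::{t2_space, second_countable_topology}, 'e::euclidean_space) chart set" +
  fixes g :: "'m \<Rightarrow> 'e \<Rightarrow> 'e \<Rightarrow> real"
  assumes inner_product_metric: "inner_product (g x)"
    and smooth_metric: "c \<in> A \<Longrightarrow> smooth_on (chart_image c) (\<lambda>y. form_in_chart A g c y u v)"

text \<open>For a metric \<open>G\<close> on an open set of a Euclidean space, \<open>christoffel G y u v\<close> is the
  Levi-Civita derivative at \<open>y\<close>, in the direction \<open>u\<close>, of the constant vector field \<open>v\<close>, as
  determined by the Koszul formula.\<close>

definition christoffel ::
    "('e::euclidean_space \<Rightarrow> 'e \<Rightarrow> 'e \<Rightarrow> real) \<Rightarrow> 'e \<Rightarrow> 'e \<Rightarrow> 'e \<Rightarrow> 'e" where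
  "christoffel G y u v = (THE z. \<forall>w. 2 * G y z w =
       frechet_derivative (\<lambda>y. G y v w) (at y) u
     + frechet_derivative (\<lambda>y. G y u w) (at y) v
     - frechet_derivative (\<lambda>y. G y u v) (at y) w)"

text \<open>The curvature \<open>\<nabla>\<^sub>u\<nabla>\<^sub>vw - \<nabla>\<^sub>v\<nabla>\<^sub>uw\<close> of constant (hence commuting) vector fields.\<close>

definition curvature ::
    "('e::euclidean_space \<Rightarrow> 'e \<Rightarrow> 'e \<Rightarrow> real) \<Rightarrow> 'e \<Rightarrow> 'e \<Rightarrow> 'e \<Rightarrow> 'e \<Rightarrow> 'e" where
  "curvature G y u v w =
       frechet_derivative (\<lambda>y. christoffel G y v w) (at y) u
     - frechet_derivative (\<lambda>y. christoffel G y u w) (at y) v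
     + christoffel G y u (christoffel G y v w) - christoffel G y v (christoffel G y u w)"

definition flat :: "('m, 'e::euclidean_space) chart set \<Rightarrow> ('m \<Rightarrow> 'e \<Rightarrow> 'e \<Rightarrow> real) \<Rightarrow> bool" where
  "flat A g \<longleftrightarrow>
     (\<forall>c\<in>A. \<forall>y\<in>chart_image c. \<forall>u v w. curvature (form_in_chart A g c) y u v w = 0)"

text \<open>\<open>\<nabla>J = 0\<close>, evaluated on constant vector fields of a chart.\<close>

definition parallel_endo ::
    "('m, 'e::euclidean_space) chart set \<Rightarrow> ('m \<Rightarrow> 'e \<Rightarrow> 'e \<Rightarrow> real) \<Rightarrow> ('m \<Rightarrow> 'e \<Rightarrow> 'e) \<Rightarrow> bool" where
  "parallel_endo A g J \<longleftrightarrow> (\<forall>c\<in>A. \<forall>y\<in>chart_image c. \<forall>u v.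
     frechet_derivative (\<lambda>y. endo_in_chart A J c y v) (at y) u
       + christoffel (form_in_chart A g c) y u (endo_in_chart A J c y v)
     = endo_in_chart A J c y (christoffel (form_in_chart A g c) y u v))"

text \<open>The index type \<open>3\<close> has the three elements \<open>1\<close>, \<open>2\<close>, \<open>3\<close>; accordingly \<open>Im \<bbbH>\<close> is \<open>real ^ 3\<close>.\<close>

locale hyper_kaehler_manifold = riemannian_manifold A g
  for A :: "('m::{t2_space, second_countable_topology}, 'e::euclidean_space) chart set"
    and g :: "'m \<Rightarrow> 'e \<Rightarrow> 'e \<Rightarrow> real" +
  fixes J :: "3 \<Rightarrow> 'm \<Rightarrow> 'e \<Rightarrow> 'e"
  assumes linear_J: "linear (J j x)"
    and smooth_J: "c \<in> A \<Longrightarrow> smooth_on (chart_image c) (\<lambda>y. endo_in_chart A (J j) c y u)"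
    and J_square: "J j x (J j x u) = - u"
    and J1_J2: "J 1 x (J 2 x u) = J 3 x u"
    and J2_J1: "J 2 x (J 1 x u) = - J 3 x u"
    and hermitian: "g x (J j x u) (J j x v) = g x u v"
    and parallel_J: "parallel_endo A g (J j)"

definition J_comb :: "(3 \<Rightarrow> 'm \<Rightarrow> 'e \<Rightarrow> 'e) \<Rightarrow> real ^ 3 \<Rightarrow> 'm \<Rightarrow> 'e \<Rightarrow> 'e::real_vector" where
  "J_comb J q x u = (\<Sum>j\<in>UNIV. (q $ j) *\<^sub>R J j x u)"

definition kaehler_form ::
    "('m \<Rightarrow> 'e \<Rightarrow> 'e \<Rightarrow> real) \<Rightarrow> (3 \<Rightarrow> 'm \<Rightarrow> 'e \<Rightarrow> 'e) \<Rightarrow> real ^ 3 \<Rightarrow> 'm \<Rightarrow> 'e \<Rightarrow> 'e::real_vector \<Rightarrow> real" where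
  "kaehler_form g J q x u v = g x (J_comb J q x u) v"


section \<open>Horizontally weakly conformal maps\<close>

definition horizontal_space ::
    "('m, 'e::real_normed_vector) chart set \<Rightarrow> ('m \<Rightarrow> 'e \<Rightarrow> 'e \<Rightarrow> real) \<Rightarrow>
     ('n, 'f::real_normed_vector) chart set \<Rightarrow> ('m \<Rightarrow> 'n) \<Rightarrow> 'm \<Rightarrow> 'e set" where
  "horizontal_space A g B f x = {u. \<forall>k. differential A B f x k = 0 \<longrightarrow> g x u k = 0}"

definition horizontally_weakly_conformal ::
    "('m::topological_space, 'e::real_normed_vector) chart set \<Rightarrow> ('m \<Rightarrow> 'e \<Rightarrow> 'e \<Rightarrow> real) \<Rightarrow>
     ('n::topological_space, 'f::real_normed_vector) chart set \<Rightarrow> ('n \<Rightarrow> 'f \<Rightarrow> 'f \<Rightarrow> real) \<Rightarrow>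
     ('m \<Rightarrow> 'n) \<Rightarrow> bool" where
  "horizontally_weakly_conformal A g B h f \<longleftrightarrow> smooth_map A B f \<and>
     (\<forall>x. (\<forall>u. differential A B f x u = 0) \<or>
       (bij_betw (differential A B f x) (horizontal_space A g B f x) UNIV \<and>
        (\<exists>l>0. \<forall>u\<in>horizontal_space A g B f x. \<forall>v\<in>horizontal_space A g B f x.
           h (f x) (differential A B f x u) (differential A B f x v) = l\<^sup>2 * g x u v)))"


section \<open>Abelian Lie groups and their actions\<close>

text \<open>The group is written additively. Its Lie algebra is the tangent space at \<open>0\<close>, hence \<open>'f\<close>.\<close>

locale abelian_lie_group = smooth_manifold B
  for B :: "('t::{t2_space, second_countable_topology, ab_group_add}, 'f::euclidean_space) chart set" +
  assumes smooth_add: "smooth_map (prod_atlas B B) B (\<lambda>(s, t). s + t)"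
    and smooth_uminus: "smooth_map B B uminus"

definition smooth_action ::
    "('t::{topological_space, ab_group_add}, 'f::euclidean_space) chart set \<Rightarrow>
     ('m::topological_space, 'e::euclidean_space) chart set \<Rightarrow> ('t \<Rightarrow> 'm \<Rightarrow> 'm) \<Rightarrow> bool" where
  "smooth_action B A act \<longleftrightarrow>
     (\<forall>x. act 0 x = x) \<and> (\<forall>s t x. act (s + t) x = act s (act t x)) \<and>
     smooth_map (prod_atlas B A) A (\<lambda>(t, x). act t x)"

definition nontrivial_action :: "('t \<Rightarrow> 'm \<Rightarrow> 'm) \<Rightarrow> bool" where
  "nontrivial_action act \<longleftrightarrow> (\<exists>x. range (\<lambda>t. act t x) \<noteq> {x})"

definition riemannian_isometry ::
    "('m::topological_space, 'e::euclidean_space) chart set \<Rightarrow> ('m \<Rightarrow> 'e \<Rightarrow> 'e \<Rightarrow> real) \<Rightarrow>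
     ('m \<Rightarrow> 'm) \<Rightarrow> bool" where
  "riemannian_isometry A g f \<longleftrightarrow> bij f \<and> smooth_map A A f \<and> smooth_map A A (inv_into UNIV f) \<and>
     (\<forall>x u v. g (f x) (differential A A f x u) (differential A A f x v) = g x u v)"

definition triholomorphic ::
    "('m::topological_space, 'e::euclidean_space) chart set \<Rightarrow> (3 \<Rightarrow> 'm \<Rightarrow> 'e \<Rightarrow> 'e) \<Rightarrow>
     ('m \<Rightarrow> 'm) \<Rightarrow> bool" where
  "triholomorphic A J f \<longleftrightarrow> smooth_map A A f \<and>
     (\<forall>j x u. differential A A f x (J j x u) = J j (f x) (differential A A f x u))"

text \<open>The velocity at time \<open>0\<close> of the curve \<open>s \<mapsto> exp (s v) \<cdot> x\<close>, i.e. the differential at the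
  neutral element of the orbit map of \<open>x\<close>, applied to \<open>v\<close>.\<close>

definition fundamental_field ::
    "('t::ab_group_add, 'f::euclidean_space) chart set \<Rightarrow> ('m, 'e::euclidean_space) chart set \<Rightarrow>
     ('t \<Rightarrow> 'm \<Rightarrow> 'm) \<Rightarrow> 'f \<Rightarrow> 'm \<Rightarrow> 'e" where
  "fundamental_field B A act v x = differential B A (\<lambda>t. act t x) 0 v"


section \<open>The hyper-Kaehler moment map\<close>

text \<open>Linear forms on the tensor product of the Lie algebra with \<open>Im \<bbbH>\<close> are
  bilinear forms on the pair, here in curried form: \<open>\<alpha> (v \<otimes> q)\<close> is
  \<open>blinfun_apply (blinfun_apply \<alpha> v) q\<close>. The linear maps in question have finite-dimensional
  domains, so boundedness is no restriction.\<close>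

type_synonym 'f moment_space = "'f \<Rightarrow>\<^sub>L ((real ^ 3) \<Rightarrow>\<^sub>L real)"

definition hyper_kaehler_moment_map ::
    "('t::{topological_space, ab_group_add}, 'f::euclidean_space) chart set \<Rightarrow>
     ('m::topological_space, 'e::euclidean_space) chart set \<Rightarrow> ('m \<Rightarrow> 'e \<Rightarrow> 'e \<Rightarrow> real) \<Rightarrow>
     (3 \<Rightarrow> 'm \<Rightarrow> 'e \<Rightarrow> 'e) \<Rightarrow> ('t \<Rightarrow> 'm \<Rightarrow> 'm) \<Rightarrow> ('m \<Rightarrow> 'f moment_space) \<Rightarrow> bool" where
  "hyper_kaehler_moment_map B A g J act \<phi> \<longleftrightarrow> smooth_map A vector_space_atlas \<phi> \<and>
     (\<forall>v q. norm q = 1 \<longrightarrow> (\<forall>x u.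
        differential A vector_space_atlas (\<lambda>x. blinfun_apply (blinfun_apply (\<phi> x) v) q) x u
        = kaehler_form g J q x (fundamental_field B A act v x) u))"

definition orthonormal_basis :: "('v::real_vector \<Rightarrow> 'v \<Rightarrow> real) \<Rightarrow> 'v set \<Rightarrow> bool" where
  "orthonormal_basis b E \<longleftrightarrow>
     (\<forall>d\<in>E. \<forall>e\<in>E. b d e = (if d = e then 1 else 0)) \<and> span E = UNIV"

text \<open>The inner product on the dual of the tensor product induced by \<open>b\<close> on the Lie algebra and
  the standard one on \<open>Im \<bbbH>\<close>: the products of orthonormal bases are an orthonormal basis of the
  tensor product, and the dual basis is orthonormal. The value does not depend on the chosen
  basis.\<close>

definition induced_inner_product ::
    "('f::euclidean_space \<Rightarrow> 'f \<Rightarrow> real) \<Rightarrow> 'f moment_space \<Rightarrow> 'f moment_space \<Rightarrow> real" where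
  "induced_inner_product b \<alpha> \<beta> =
     (\<Sum>e\<in>(SOME E. orthonormal_basis b E). \<Sum>q\<in>Basis.
        blinfun_apply (blinfun_apply \<alpha> e) q * blinfun_apply (blinfun_apply \<beta> e) q)"


section \<open>Betti numbers\<close>

definition Z_independent :: "('a, 'b) monoid_scheme \<Rightarrow> 'a set \<Rightarrow> bool" where
  "Z_independent G S \<longleftrightarrow> (\<forall>n :: 'a \<Rightarrow> int.
     finprod G (\<lambda>x. x [^]\<^bsub>G\<^esub> n x) S = \<one>\<^bsub>G\<^esub> \<longrightarrow> (\<forall>x\<in>S. n x = 0))"

definition abelian_group_rank :: "('a, 'b) monoid_scheme \<Rightarrow> enat" where
  "abelian_group_rank G =
     (SUP S\<in>{S. finite S \<and> S \<subseteq> carrier G \<and> Z_independent G S}. enat (card S))"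

text \<open>The library's singular homology has integer coefficients; the rank of the group is the
  dimension of the homology with real coefficients if that is finite, and \<open>\<infinity>\<close> otherwise.\<close>

definition betti_number :: "int \<Rightarrow> 'a topology \<Rightarrow> enat" where
  "betti_number p X = abelian_group_rank (homology_group p X)"

end

theory Submission
  imports Defs
begin

text \<open>Let \<open>E\<close> be an orthonormal basis of the Lie algebra, \<open>V e\<close> the fundamental field of \<open>e \<in> E\<close>, and
  \<open>A e = \<nabla>(V e)\<close>. The fields \<open>J j (V e)\<close> are the gradients of the coordinates of the moment map, so
  horizontal weak conformality says that they are pairwise orthogonal of the same length; by
  quaternionic algebra the same is true of the \<open>V e\<close> and \<open>J j (V e)\<close> together. Let \<open>f\<close> be the common
  square of their lengths. Gradients have symmetric covariant derivatives, and the symmetry of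
  \<open>J j \<circ> A e\<close> for all three \<open>j\<close> forces \<open>A e\<close> to be skew and to commute with each \<open>J j\<close>.
  Differentiating \<open>g (J j (V e)) (V e') = 0\<close> gives \<open>A e (V e') = A e' (V e)\<close>, and then
  differentiating \<open>g (V e) (V e') = 0\<close> gives \<open>A e (V e') = 0\<close> for \<open>e \<noteq> e'\<close>. Since
  \<open>df = - 2 g (A e (V e))\<close> for every \<open>e\<close> and there are at least two of them, \<open>df = 0\<close>. So \<open>f\<close> is
  constant, and it is not zero because otherwise all fundamental fields would vanish and the
  connected group would act trivially. Now \<open>A e (V e) = 0\<close> as well, the \<open>V e\<close> and \<open>J j (V e)\<close> form a
  parallel orthogonal frame, and the curvature vanishes.\<close>

section \<open>Calculus of iterated directional derivatives\<close>

lemma frechet_derivative_eqI: "(f has_derivative f') (at x) \<Longrightarrow> frechet_derivative f (at x) = f'"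
  using frechet_derivative_at by metis

lemma differentiable_has_derivative:
  "f differentiable (at x) \<Longrightarrow> (f has_derivative frechet_derivative f (at x)) (at x)"
  by (simp add: frechet_derivative_works)

lemma differentiable_transform_within_open:
  assumes "f differentiable (at x)" "open S" "x \<in> S" "\<And>y. y \<in> S \<Longrightarrow> f y = g y"
  shows "g differentiable (at x)"
  using assms has_derivative_transform_within_open unfolding differentiable_def by metis

text \<open>\<open>frechet_derivative\<close> at a point sees a whole neighbourhood of it, so
  agreement on an open set passes to the derivatives of every order.\<close>

lemma C_k_on_cong:
  assumes "open S" "\<And>x. x \<in> S \<Longrightarrow> f x = g x" "C_k_on k S f"
  shows "C_k_on k S g"
  using assms(2,3)
proof (induction k arbitrary: f g)
  case 0
  then show ?case using continuous_on_cong[of S S f g] by simp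
next
  case (Suc k)
  have d: "g differentiable (at x)" "frechet_derivative f (at x) = frechet_derivative g (at x)"
    if "x \<in> S" for x
  proof -
    have f: "f differentiable (at x)" using Suc.prems(2) that by simp
    show "g differentiable (at x)"
      by (rule differentiable_transform_within_open[OF f \<open>open S\<close> that]) (rule Suc.prems(1))
    show "frechet_derivative f (at x) = frechet_derivative g (at x)"
      by (rule frechet_derivative_transform_within_open[OF f \<open>open S\<close> that]) (rule Suc.prems(1))
  qed
  show ?case
    unfolding C_k_on.simps
  proof (intro conjI ballI allI)
    fix v
    show "C_k_on k S (\<lambda>x. frechet_derivative g (at x) v)"
      by (rule Suc.IH[of "\<lambda>x. frechet_derivative f (at x) v"]) (use d Suc.prems(2) in auto)
  qed (rule d(1))
qed

lemma C_k_on_imp_continuous_on: "C_k_on k S f \<Longrightarrow> continuous_on S f"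
  by (cases k) (auto intro!: continuous_at_imp_continuous_on differentiable_imp_continuous_within)

lemma C_k_on_SucD: "C_k_on (Suc k) S f \<Longrightarrow> C_k_on k S f"
proof (induction k arbitrary: f)
  case 0
  then show ?case using C_k_on_imp_continuous_on[OF 0] by simp
next
  case (Suc k)
  then show ?case by (subst C_k_on.simps) (metis C_k_on.simps(2))
qed

text \<open>Lets a derivative known by a formula on \<open>S\<close> stand in for
  \<open>frechet_derivative\<close>. This is the induction step of the closure properties
  below.\<close>

lemma C_k_on_SucI:
  assumes S: "open S" and f: "\<And>x. x \<in> S \<Longrightarrow> (f has_derivative f' x) (at x)"
    and f': "\<And>v. C_k_on k S (\<lambda>x. f' x v)"
  shows "C_k_on (Suc k) S f"
  unfolding C_k_on.simps
proof (intro conjI ballI allI)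
  fix x assume "x \<in> S" then show "f differentiable (at x)" using f differentiableI by blast
next
  fix v
  show "C_k_on k S (\<lambda>x. frechet_derivative f (at x) v)"
    by (rule C_k_on_cong[OF S _ f'[of v]]) (simp add: frechet_derivative_eqI[OF f])
qed

lemma C_k_on_SucE:
  assumes "C_k_on (Suc k) S f" "x \<in> S"
  shows "(f has_derivative frechet_derivative f (at x)) (at x)"
  using assms frechet_derivative_works by auto

lemma C_k_on_const: "open S \<Longrightarrow> C_k_on k S (\<lambda>x. c)"
proof (induction k arbitrary: c)
  case (Suc k)
  show ?case by (rule C_k_on_SucI[where f' = "\<lambda>x v. 0"]) (use Suc in auto)
qed simp

lemma C_k_on_add:
  assumes "open S" "C_k_on k S f" "C_k_on k S g"
  shows "C_k_on k S (\<lambda>x. f x + g x)"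
  using assms(2,3)
proof (induction k arbitrary: f g)
  case 0
  then show ?case by (simp add: continuous_on_add)
next
  case (Suc k)
  show ?case
    by (rule C_k_on_SucI[OF assms(1), where
          f' = "\<lambda>x v. frechet_derivative f (at x) v + frechet_derivative g (at x) v"])
      (use Suc in \<open>auto intro!: has_derivative_add C_k_on_SucE simp del: C_k_on.simps\<close>, 
       use Suc in auto)
qed

lemma C_k_on_sum:
  assumes "open S" "\<And>i. i \<in> I \<Longrightarrow> C_k_on k S (f i)"
  shows "C_k_on k S (\<lambda>x. \<Sum>i\<in>I. f i x)"
  using assms(2)
  by (induction I rule: infinite_finite_induct)
    (auto intro!: C_k_on_add C_k_on_const assms(1))

lemma C_k_on_scaleR:
  fixes f :: "'a::real_normed_vector \<Rightarrow> real" and g :: "'a \<Rightarrow> 'b::real_normed_vector"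
  assumes "open S" "C_k_on k S f" "C_k_on k S g"
  shows "C_k_on k S (\<lambda>x. f x *\<^sub>R g x)"
  using assms(2,3)
proof (induction k arbitrary: f g)
  case 0
  then show ?case by (simp add: continuous_on_scaleR)
next
  case (Suc k)
  note d = C_k_on_SucE[OF Suc.prems(1)] C_k_on_SucE[OF Suc.prems(2)]
  note c = C_k_on_SucD[OF Suc.prems(1)] C_k_on_SucD[OF Suc.prems(2)]
  show ?case
  proof (rule C_k_on_SucI[OF assms(1)])
    show "((\<lambda>x. f x *\<^sub>R g x) has_derivative
        (\<lambda>v. f x *\<^sub>R frechet_derivative g (at x) v + frechet_derivative f (at x) v *\<^sub>R g x)) (at x)"
      if "x \<in> S" for x
      by (rule has_derivative_scaleR[OF d(1)[OF that] d(2)[OF that]])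
    show "C_k_on k S (\<lambda>x. f x *\<^sub>R frechet_derivative g (at x) v + frechet_derivative f (at x) v *\<^sub>R g x)" for v
      by (rule C_k_on_add[OF assms(1)]) (use Suc.prems in \<open>auto intro!: Suc.IH c simp del: C_k_on.simps simp add: C_k_on.simps(2)\<close>)
  qed
qed

lemma C_k_on_bounded_linear:
  assumes L: "bounded_linear L" and S: "open S" and "C_k_on k S f"
  shows "C_k_on k S (\<lambda>x. L (f x))"
  using assms(3)
proof (induction k arbitrary: f)
  case 0
  then show ?case using bounded_linear.continuous_on[OF L] by simp
next
  case (Suc k)
  show ?case
  proof (rule C_k_on_SucI[OF S])
    show "((\<lambda>x. L (f x)) has_derivative (\<lambda>v. L (frechet_derivative f (at x) v))) (at x)"
      if "x \<in> S" for x
      by (rule bounded_linear.has_derivative[OF L C_k_on_SucE[OF Suc.prems that]])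
    show "C_k_on k S (\<lambda>x. L (frechet_derivative f (at x) v))" for v
      by (rule Suc.IH) (use Suc.prems in auto)
  qed
qed

lemma linear_euclidean_sum:
  fixes z :: "'e::euclidean_space"
  assumes "linear K"
  shows "K z = (\<Sum>i\<in>Basis. (z \<bullet> i) *\<^sub>R K i)"
proof -
  have "K z = K (\<Sum>i\<in>Basis. (z \<bullet> i) *\<^sub>R i)" by (simp add: euclidean_representation)
  also have "\<dots> = (\<Sum>i\<in>Basis. (z \<bullet> i) *\<^sub>R K i)"
    by (simp add: linear_sum[OF assms] linear_cmul[OF assms])
  finally show ?thesis .
qed

text \<open>Metric and complex structures are smooth through their coefficients on fixed vectors
  only. Expanding \<open>Z y\<close> in the standard basis extends this to moving vector
  fields.\<close>

lemma C_k_on_linear_family: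
  fixes K :: "'a::real_normed_vector \<Rightarrow> 'e::euclidean_space \<Rightarrow> 'b::real_normed_vector"
  assumes S: "open S" and lin: "\<And>y. y \<in> S \<Longrightarrow> linear (K y)"
    and K: "\<And>v. C_k_on k S (\<lambda>y. K y v)" and Z: "C_k_on k S Z"
  shows "C_k_on k S (\<lambda>y. K y (Z y))"
proof (rule C_k_on_cong[OF S])
  have "C_k_on k S (\<lambda>y. (Z y \<bullet> i) *\<^sub>R K y i)" for i
    using C_k_on_scaleR[OF S C_k_on_bounded_linear[OF bounded_linear_inner_left[of i] S Z] K[of i]] .
  then show "C_k_on k S (\<lambda>y. \<Sum>i\<in>Basis. (Z y \<bullet> i) *\<^sub>R K y i)"
    using C_k_on_sum[OF S, of Basis k "\<lambda>i y. (Z y \<bullet> i) *\<^sub>R K y i"] by blast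
  show "(\<Sum>i\<in>Basis. (Z y \<bullet> i) *\<^sub>R K y i) = K y (Z y)" if "y \<in> S" for y
    by (rule linear_euclidean_sum[OF lin[OF that], symmetric])
qed

text \<open>The product rule for evaluating a field of linear maps on a vector field. As
  \<open>K\<close> is differentiable on each fixed vector only, the basis expansion turns the
  evaluation into a finite sum of products of functions of one point.\<close>

lemma has_derivative_linear_family:
  fixes K :: "'a::real_normed_vector \<Rightarrow> 'e::euclidean_space \<Rightarrow> 'b::real_normed_vector"
  assumes S: "open S" "x \<in> S" and lin: "\<And>y. y \<in> S \<Longrightarrow> linear (K y)"
    and K: "\<And>v. (\<lambda>y. K y v) differentiable (at x)" and Z: "(Z has_derivative Z') (at x)"
  shows "((\<lambda>y. K y (Z y)) has_derivative
    (\<lambda>u. frechet_derivative (\<lambda>y. K y (Z x)) (at x) u + K x (Z' u))) (at x)"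
proof -
  let ?D = "\<lambda>v. frechet_derivative (\<lambda>y. K y v) (at x)"
  have K': "((\<lambda>y. K y v) has_derivative ?D v) (at x)" for v
    using K frechet_derivative_works by blast
  have "((\<lambda>y. \<Sum>i\<in>Basis. (Z y \<bullet> i) *\<^sub>R K y i) has_derivative
    (\<lambda>u. \<Sum>i\<in>Basis. (Z x \<bullet> i) *\<^sub>R ?D i u + (Z' u \<bullet> i) *\<^sub>R K x i)) (at x)"
    by (intro has_derivative_sum has_derivative_scaleR K' has_derivative_inner_left Z)
  then have 1: "((\<lambda>y. K y (Z y)) has_derivative
    (\<lambda>u. \<Sum>i\<in>Basis. (Z x \<bullet> i) *\<^sub>R ?D i u + (Z' u \<bullet> i) *\<^sub>R K x i)) (at x)"
    by (rule has_derivative_transform_within_open[OF _ S])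
      (rule linear_euclidean_sum[OF lin, symmetric])
  have "((\<lambda>y. \<Sum>i\<in>Basis. (Z x \<bullet> i) *\<^sub>R K y i) has_derivative
    (\<lambda>u. \<Sum>i\<in>Basis. (Z x \<bullet> i) *\<^sub>R ?D i u)) (at x)"
    by (intro has_derivative_sum has_derivative_scaleR_right K')
  then have "((\<lambda>y. K y (Z x)) has_derivative
    (\<lambda>u. \<Sum>i\<in>Basis. (Z x \<bullet> i) *\<^sub>R ?D i u)) (at x)"
    by (rule has_derivative_transform_within_open[OF _ S])
      (rule linear_euclidean_sum[OF lin, symmetric])
  from frechet_derivative_eqI[OF this]
  have "(\<lambda>u. \<Sum>i\<in>Basis. (Z x \<bullet> i) *\<^sub>R ?D i u + (Z' u \<bullet> i) *\<^sub>R K x i)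
      = (\<lambda>u. ?D (Z x) u + K x (Z' u))"
    by (simp add: sum.distrib linear_euclidean_sum[OF lin[OF S(2)], of "Z' _"])
  with 1 show ?thesis by simp
qed

lemma C_k_on_slice:
  fixes h :: "'a::real_normed_vector \<times> 'b::real_normed_vector \<Rightarrow> 'c::real_normed_vector"
  assumes S: "open S" and sub: "\<And>y. y \<in> S \<Longrightarrow> (x, y) \<in> W" and "C_k_on k W h"
  shows "C_k_on k S (\<lambda>y. h (x, y))"
  using assms(3)
proof (induction k arbitrary: h)
  case 0
  have "continuous_on S (h \<circ> Pair x)"
    by (rule continuous_on_compose)
      (use 0 sub in \<open>auto intro!: continuous_intros elim: continuous_on_subset\<close>)
  then show ?case by (simp add: o_def)
next
  case (Suc k)
  show ?case
  proof (rule C_k_on_SucI[OF S])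
    show "((\<lambda>y. h (x, y)) has_derivative (\<lambda>v. frechet_derivative h (at (x, y)) (0, v))) (at y)"
      if "y \<in> S" for y
    proof -
      have "(Pair x has_derivative Pair 0) (at y)"
        by (intro has_derivative_Pair has_derivative_const has_derivative_ident)
      from diff_chain_at[OF this C_k_on_SucE[OF Suc.prems sub[OF that]]] show ?thesis
        by (simp add: o_def)
    qed
    show "C_k_on k S (\<lambda>y. frechet_derivative h (at (x, y)) (0, v))" for v
      by (rule Suc.IH) (use Suc.prems in auto)
  qed
qed

section \<open>Symmetry of second derivatives\<close>

lemma double_difference_mean_value:
  fixes f :: "'a::real_normed_vector \<Rightarrow> real"
  assumes f: "C_k_on 2 S f" and s: "0 < s"
    and sub: "\<And>a b. 0 \<le> a \<Longrightarrow> a \<le> s \<Longrightarrow> 0 \<le> b \<Longrightarrow> b \<le> s \<Longrightarrow> x + a *\<^sub>R u + b *\<^sub>R v \<in> S"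
  obtains a b where "0 < a" "a < s" "0 < b" "b < s"
    "f (x + s *\<^sub>R u + s *\<^sub>R v) - f (x + s *\<^sub>R u) - f (x + s *\<^sub>R v) + f x
      = s * s * frechet_derivative (\<lambda>y. frechet_derivative f (at y) u) (at (x + a *\<^sub>R u + b *\<^sub>R v)) v"
proof -
  let ?D = "\<lambda>y. frechet_derivative f (at y)"
  let ?D2 = "\<lambda>y. frechet_derivative (\<lambda>y. frechet_derivative f (at y) u) (at y)"
  have d1: "(f has_derivative ?D y) (at y)" if "y \<in> S" for y
    using C_k_on_SucE[OF f[unfolded numeral_2_eq_2] that] .
  have "C_k_on (Suc 0) S (\<lambda>y. ?D y u)"
    using f unfolding numeral_2_eq_2 C_k_on.simps(2)[of "Suc 0"] by blast
  then have d2: "((\<lambda>y. ?D y u) has_derivative ?D2 y) (at y)" if "y \<in> S" for y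
    using C_k_on_SucE that by blast
  have line: "((\<lambda>a. h (p + a *\<^sub>R w)) has_derivative (\<lambda>r. r * H w)) (at a)"
    if "(h has_derivative H) (at (p + a *\<^sub>R w))"
    for h :: "'a \<Rightarrow> real" and H p w and a :: real
  proof -
    have "((\<lambda>a. p + a *\<^sub>R w) has_derivative (\<lambda>r. r *\<^sub>R w)) (at a)"
      by (auto intro!: derivative_eq_intros)
    from diff_chain_at[OF this that] show ?thesis
      using linear_cmul[OF has_derivative_linear[OF that]] by (simp add: o_def)
  qed
  \<comment> \<open>The increment of \<open>?k\<close> over the interval from 0 to \<open>s\<close>
    is the double difference. One mean value theorem along \<open>u\<close> replaces it by a
    difference of first derivatives, a second one along \<open>v\<close> reduces that to a second
    derivative.\<close>
  let ?k = "\<lambda>a. f (x + s *\<^sub>R v + a *\<^sub>R u) - f (x + a *\<^sub>R u)"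
  let ?k' = "\<lambda>a. ?D (x + s *\<^sub>R v + a *\<^sub>R u) u - ?D (x + a *\<^sub>R u) u"
  have k': "(?k has_derivative (\<lambda>r. r * ?k' a)) (at a within {0..s})" if "0 \<le> a" "a \<le> s" for a
  proof -
    have "x + s *\<^sub>R v + a *\<^sub>R u \<in> S" "x + a *\<^sub>R u \<in> S"
      using sub[of a s] sub[of a 0] that s by (auto simp: algebra_simps)
    from has_derivative_diff[OF line[OF d1[OF this(1)]] line[OF d1[OF this(2)]]]
    show ?thesis by (simp add: algebra_simps has_derivative_at_withinI)
  qed
  obtain a where a: "0 < a" "a < s" "?k s - ?k 0 = s * ?k' a"
    using mvt_simple[OF s, of ?k "\<lambda>a r. r * ?k' a"] k' s by auto
  let ?m = "\<lambda>b. ?D (x + a *\<^sub>R u + b *\<^sub>R v) u"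
  have m': "(?m has_derivative (\<lambda>r. r * ?D2 (x + a *\<^sub>R u + b *\<^sub>R v) v)) (at b within {0..s})"
    if "0 \<le> b" "b \<le> s" for b
    using line[OF d2[OF sub[of a b]]] a that by (simp add: has_derivative_at_withinI)
  obtain b where b: "0 < b" "b < s" "?m s - ?m 0 = s * ?D2 (x + a *\<^sub>R u + b *\<^sub>R v) v"
    using mvt_simple[OF s, of ?m "\<lambda>b r. r * ?D2 (x + a *\<^sub>R u + b *\<^sub>R v) v"] m' s by auto
  have "?k s - ?k 0 = s * (s * ?D2 (x + a *\<^sub>R u + b *\<^sub>R v) v)"
    using a(3) b(3) by (simp add: algebra_simps)
  then show ?thesis using that a b by (simp add: algebra_simps)
qed

text \<open>The double difference over a small parallelogram with sides along \<open>u\<close> and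
  \<open>v\<close> does not depend on their order. Hence both mixed derivatives take a common value
  at points near \<open>x\<close>, and continuity makes them agree at \<open>x\<close>.\<close>

lemma symmetric_second_frechet_derivative:
  fixes f :: "'a::real_normed_vector \<Rightarrow> real"
  assumes S: "open S" "x \<in> S" and f: "C_k_on 2 S f"
  shows "frechet_derivative (\<lambda>y. frechet_derivative f (at y) u) (at x) v
       = frechet_derivative (\<lambda>y. frechet_derivative f (at y) v) (at x) u"
proof (rule ccontr)
  define D2 where "D2 u v y = frechet_derivative (\<lambda>y. frechet_derivative f (at y) u) (at y) v" for u v y
  assume "\<not> ?thesis"
  then have e: "0 < dist (D2 u v x) (D2 v u x) / 2" (is "0 < ?e") by (simp add: D2_def)
  have cont: "continuous_on S (D2 u v)" for u v
    using f unfolding D2_def by (auto simp: numeral_2_eq_2)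
  have near: "\<exists>d>0. \<forall>y. dist y x < d \<longrightarrow> y \<in> S \<and> dist (D2 u v y) (D2 u v x) < ?e" for u v
  proof -
    obtain d where "d > 0" "\<And>y. y \<in> S \<Longrightarrow> dist y x < d \<Longrightarrow> dist (D2 u v y) (D2 u v x) < ?e"
      using cont S(2) e unfolding continuous_on_iff by blast
    moreover obtain d' where "d' > 0" "ball x d' \<subseteq> S" using S open_contains_ball by blast
    ultimately show ?thesis
      by (intro exI[of _ "min d d'"]) (auto simp: dist_commute mem_ball subset_iff)
  qed
  obtain d1 where d1: "d1 > 0" "\<And>y. dist y x < d1 \<Longrightarrow> y \<in> S \<and> dist (D2 u v y) (D2 u v x) < ?e"
    using near by blast
  obtain d2 where d2: "d2 > 0" "\<And>y. dist y x < d2 \<Longrightarrow> y \<in> S \<and> dist (D2 v u y) (D2 v u x) < ?e"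
    using near by blast
  \<comment> \<open>Small enough to keep the whole parallelogram within both radii; the summand 1
    keeps the denominator positive when \<open>u\<close> and \<open>v\<close> are both zero.\<close>
  define s where "s = min d1 d2 / (2 * (norm u + norm v + 1))"
  have s: "s > 0" using d1(1) d2(1)
    by (auto simp: s_def intro!: divide_pos_pos mult_pos_pos add_nonneg_pos)
  have close: "dist (x + a *\<^sub>R u + b *\<^sub>R v) x < min d1 d2" if "0 \<le> a" "a \<le> s" "0 \<le> b" "b \<le> s" for a b
  proof -
    have "dist (x + a *\<^sub>R u + b *\<^sub>R v) x \<le> norm (a *\<^sub>R u) + norm (b *\<^sub>R v)"
      using norm_triangle_ineq[of "a *\<^sub>R u" "b *\<^sub>R v"] by (simp add: dist_norm add.assoc)
    also have "\<dots> \<le> s * norm u + s * norm v"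
      using that by (auto intro!: add_mono mult_right_mono)
    also have "\<dots> < s * (2 * (norm u + norm v + 1))"
    proof -
      have "norm u + norm v < 2 * (norm u + norm v + 1)"
        using add_nonneg_nonneg[OF norm_ge_zero[of u] norm_ge_zero[of v]] unfolding distrib_left by linarith
      from mult_strict_left_mono[OF this s] show ?thesis by (simp add: distrib_left)
    qed
    also have "\<dots> = min d1 d2"
    proof -
      have "2 * (norm u + norm v + 1) \<noteq> 0"
        using add_nonneg_nonneg[OF norm_ge_zero[of u] norm_ge_zero[of v]] unfolding distrib_left by linarith
      then show ?thesis unfolding s_def by (rule nonzero_eq_divide_eq[THEN iffD1, OF _ refl])
    qed
    finally show ?thesis .
  qed
  have close': "dist (x + a *\<^sub>R v + b *\<^sub>R u) x < min d1 d2" if "0 \<le> a" "a \<le> s" "0 \<le> b" "b \<le> s" for a b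
    using close[OF that(3,4,1,2)] by (simp add: algebra_simps)
  have sub: "x + a *\<^sub>R u + b *\<^sub>R v \<in> S" "x + a *\<^sub>R v + b *\<^sub>R u \<in> S"
    if "0 \<le> a" "a \<le> s" "0 \<le> b" "b \<le> s" for a b
    using close[OF that] close'[OF that] d1(2) by auto
  obtain a b where ab: "0 < a" "a < s" "0 < b" "b < s"
    "f (x + s *\<^sub>R u + s *\<^sub>R v) - f (x + s *\<^sub>R u) - f (x + s *\<^sub>R v) + f x
      = s * s * D2 u v (x + a *\<^sub>R u + b *\<^sub>R v)"
    by (rule double_difference_mean_value[OF f s sub(1), folded D2_def])
  obtain a' b' where ab': "0 < a'" "a' < s" "0 < b'" "b' < s"
    "f (x + s *\<^sub>R v + s *\<^sub>R u) - f (x + s *\<^sub>R v) - f (x + s *\<^sub>R u) + f x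
      = s * s * D2 v u (x + a' *\<^sub>R v + b' *\<^sub>R u)"
    by (rule double_difference_mean_value[OF f s sub(2), folded D2_def])
  have "s * s * D2 u v (x + a *\<^sub>R u + b *\<^sub>R v) = s * s * D2 v u (x + a' *\<^sub>R v + b' *\<^sub>R u)"
    using ab(5) ab'(5) by (simp add: algebra_simps)
  then have "D2 u v (x + a *\<^sub>R u + b *\<^sub>R v) = D2 v u (x + a' *\<^sub>R v + b' *\<^sub>R u)"
    using s by simp
  moreover have "dist (D2 u v (x + a *\<^sub>R u + b *\<^sub>R v)) (D2 u v x) < ?e"
    using close[of a b] ab d1(2) by auto
  moreover have "dist (D2 v u (x + a' *\<^sub>R v + b' *\<^sub>R u)) (D2 v u x) < ?e"
    using close'[of a' b'] ab' d2(2) by auto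
  ultimately show False
    using dist_triangle3[of "D2 u v x" "D2 v u x" "D2 u v (x + a *\<^sub>R u + b *\<^sub>R v)"] by simp
qed

section \<open>Quaternionic linear algebra\<close>

lemma inner_product_bilinear: "inner_product b \<Longrightarrow> bilinear b"
  and inner_product_commute: "inner_product b \<Longrightarrow> b u v = b v u"
  and inner_product_pos: "inner_product b \<Longrightarrow> u \<noteq> 0 \<Longrightarrow> b u u > 0"
  by (auto simp: inner_product_def)

lemma inner_product_linear:
  assumes "inner_product b"
  shows "linear (b u)" "linear (\<lambda>u. b u v)"
  using inner_product_bilinear[OF assms] by (auto simp: bilinear_def)

lemmas inner_product_simps =
  bilinear_ladd[OF inner_product_bilinear] bilinear_radd[OF inner_product_bilinear]
  bilinear_lsub[OF inner_product_bilinear] bilinear_rsub[OF inner_product_bilinear]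
  bilinear_lneg[OF inner_product_bilinear] bilinear_rneg[OF inner_product_bilinear]
  bilinear_lmul[OF inner_product_bilinear] bilinear_rmul[OF inner_product_bilinear]
  bilinear_lzero[OF inner_product_bilinear] bilinear_rzero[OF inner_product_bilinear]

lemma inner_product_eq_0: "inner_product b \<Longrightarrow> b u u = 0 \<longleftrightarrow> u = 0"
  using inner_product_pos[of b u] by (cases "u = 0") (auto simp: inner_product_simps)

lemma inner_product_eqI:
  assumes b: "inner_product b" and eq: "\<And>w. b x w = b y w"
  shows "x = y"
proof -
  have "b (x - y) (x - y) = 0" by (simp add: bilinear_lsub[OF inner_product_bilinear[OF b]] eq)
  then show ?thesis using inner_product_eq_0[OF b] by simp
qed

text \<open>Riesz representation. \<open>T\<close> is the operator that expresses \<open>b\<close>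
  through the standard inner product; positivity makes it injective, and finite dimension then makes
  it surjective.\<close>

lemma inner_product_representation:
  fixes b :: "'e::euclidean_space \<Rightarrow> 'e \<Rightarrow> real"
  assumes b: "inner_product b" and \<alpha>: "linear \<alpha>"
  shows "\<exists>!z. \<forall>w. b z w = \<alpha> w"
proof -
  define T where "T z = (\<Sum>i\<in>Basis. b z i *\<^sub>R i)" for z
  have T_inner: "T z \<bullet> w = b z w" for z w
    using linear_euclidean_sum[OF inner_product_linear(1)[OF b], of z w]
    by (simp add: T_def inner_sum_left inner_commute[of w] mult.commute)
  have lin: "linear T"
    by (rule linearI; rule vector_eq_rdot[THEN iffD1])
      (simp_all add: inner_simps T_inner inner_product_simps[OF b])
  have "inj T"
  proof (rule linear_injective_0[OF lin, THEN iffD2], intro allI impI)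
    fix z assume "T z = 0"
    then have "b z z = 0" using T_inner[of z z] by simp
    then show "z = 0" using inner_product_eq_0[OF b] by simp
  qed
  then have "surj T" using linear_injective_imp_surjective[OF lin] by blast
  then obtain z where "T z = (\<Sum>i\<in>Basis. \<alpha> i *\<^sub>R i)" by (metis surjD)
  then have "b z w = \<alpha> w" for w
    using T_inner[of z w] linear_euclidean_sum[OF \<alpha>, of w]
    by (simp add: inner_sum_left inner_commute[of w] mult.commute)
  then show ?thesis using inner_product_eqI[OF b] by metis
qed

lemma orthogonal_independent:
  assumes b: "inner_product b" and f: "f \<noteq> 0"
    and B: "\<And>x y. x \<in> B \<Longrightarrow> y \<in> B \<Longrightarrow> b x y = (if x = y then f else 0)"
  shows "independent B"
  unfolding independent_explicit_module
proof (intro allI impI)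
  fix t u v assume t: "finite t" "t \<subseteq> B" "(\<Sum>x\<in>t. u x *\<^sub>R x) = 0" "v \<in> t"
  have "0 = b (\<Sum>x\<in>t. u x *\<^sub>R x) v" by (simp add: t inner_product_simps[OF b])
  also have "\<dots> = (\<Sum>x\<in>t. u x * b x v)"
    by (simp add: linear_sum[OF inner_product_linear(2)[OF b]] inner_product_simps[OF b])
  also have "\<dots> = (\<Sum>x\<in>t. if x = v then u v * f else 0)"
    using t by (intro sum.cong) (auto simp: B subset_iff)
  also have "\<dots> = u v * f" using t by simp
  finally show "u v = 0" using f by simp
qed

text \<open>Orthogonality with a nonzero common square makes the family injective and independent,
  so the count of indices makes it a basis. The expansion then holds because both sides have the
  same products with the frame.\<close>

lemma orthogonal_frame_expansion:
  fixes b :: "'e::euclidean_space \<Rightarrow> 'e \<Rightarrow> real"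
  assumes b: "inner_product b" and f: "f \<noteq> 0" and K: "finite K" "card K = DIM('e)"
    and P: "\<And>k l. k \<in> K \<Longrightarrow> l \<in> K \<Longrightarrow> b (P k) (P l) = (if k = l then f else 0)"
  shows "span (P ` K) = UNIV" "z = (\<Sum>k\<in>K. (b z (P k) / f) *\<^sub>R P k)"
proof -
  have inj: "inj_on P K"
  proof (rule inj_onI)
    fix k l assume "k \<in> K" "l \<in> K" "P k = P l"
    then show "k = l" using P[of k k] P[of k l] f by (metis (full_types))
  qed
  have "independent (P ` K)"
    by (rule orthogonal_independent[OF b f]) (auto simp: P inj_on_eq_iff[OF inj])
  moreover have "card (P ` K) = DIM('e)" using K by (simp add: card_image inj)
  ultimately show span: "span (P ` K) = UNIV"
    using card_ge_dim_independent[of "P ` K" UNIV] by auto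
  let ?z = "\<Sum>k\<in>K. (b z (P k) / f) *\<^sub>R P k"
  have "b ?z (P l) = b z (P l)" if "l \<in> K" for l
  proof -
    have "b ?z (P l) = (\<Sum>k\<in>K. (b z (P k) / f) * b (P k) (P l))"
      by (simp add: linear_sum[OF inner_product_linear(2)[OF b]] inner_product_simps[OF b])
    also have "\<dots> = (\<Sum>k\<in>K. if k = l then b z (P l) else 0)"
      using that f by (intro sum.cong) (auto simp: P)
    finally show ?thesis using that K by simp
  qed
  then have eq: "x \<in> P ` K \<Longrightarrow> b z x = b ?z x" for x by (metis imageE)
  have "b z w = b ?z w" for w
    by (rule linear_eq_on[OF inner_product_linear(1)[OF b] inner_product_linear(1)[OF b] _ eq, of w "P ` K"])
      (simp_all only: span UNIV_I)
  then show "z = ?z" by (rule inner_product_eqI[OF b])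
qed

text \<open>The linear algebra of one point, used both for the tangent spaces of the manifold and
  for coordinate vectors in a chart.\<close>

locale hyper_hermitian =
  fixes b :: "'e::euclidean_space \<Rightarrow> 'e \<Rightarrow> real" and J :: "3 \<Rightarrow> 'e \<Rightarrow> 'e"
  assumes ip: "inner_product b" and linear_J: "linear (J j)" and J_square: "J j (J j u) = - u"
    and J1_J2: "J 1 (J 2 u) = J 3 u" and J2_J1: "J 2 (J 1 u) = - J 3 u"
    and hermitian: "b (J j u) (J j v) = b u v"
begin

lemmas b_simps = inner_product_simps[OF ip]
lemmas J_simps = linear_0[OF linear_J] linear_add[OF linear_J] linear_neg[OF linear_J]
  linear_diff[OF linear_J] linear_cmul[OF linear_J]

lemma b_J_left: "b (J j u) v = - b u (J j v)"
  using hermitian[of j "u" "J j v"] by (simp add: J_square b_simps)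

text \<open>Applying a second complex structure to both arguments turns the product into one of
  \<open>J i u\<close> and \<open>J k v\<close>, up to sign, with distinct \<open>i\<close> and
  \<open>k\<close>.\<close>

lemma b_J_orthogonal:
  assumes "\<And>i j. b (J i u) (J j v) = (if i = j then f else 0)"
  shows "b (J j u) v = 0"
proof -
  consider "j = 1" | "j = 2" | "j = 3" using exhaust_3[of j] by blast
  then show ?thesis
  proof cases
    case 1
    have "b (J 1 u) v = b (J 2 (J 1 u)) (J 2 v)" by (simp add: hermitian)
    then show ?thesis using assms[of 3 2] 1 by (simp add: J2_J1 b_simps)
  next
    case 2
    have "b (J 2 u) v = b (J 1 (J 2 u)) (J 1 v)" by (simp add: hermitian)
    then show ?thesis using assms[of 3 1] 2 by (simp add: J1_J2)
  next
    case 3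
    have "b (J 3 u) v = b (J 1 (J 3 u)) (J 1 v)" by (simp add: hermitian)
    also have "J 1 (J 3 u) = - J 2 u" by (simp add: J1_J2[symmetric] J_square)
    finally show ?thesis using assms[of 2 1] 3 by (simp add: b_simps)
  qed
qed

text \<open>A vector field is Killing and triholomorphic as soon as its images under the three complex
  structures are gradients; here \<open>A\<close> is its covariant derivative.\<close>

lemma skew_commuting:
  assumes sym: "\<And>j u v. b (J j (A u)) v = b (J j (A v)) u"
  shows "b (A u) v = - b u (A v)" "A (J j u) = J j (A u)"
proof -
  have 1: "b (A u) (J j v) = b (A v) (J j u)" for j u v
    using sym[of j u v] by (simp add: b_J_left)
  have 2: "b (A u) v = - b (A (J j v)) (J j u)" for j u v
    using 1[of u j "J j v"] by (simp add: J_square b_simps)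
  \<comment> \<open>Each use of fact 2 exchanges \<open>u\<close> and \<open>v\<close> with a sign.
    The structures 1 and 2 together restore the order, and a third use removes their product
    \<open>- J 3\<close>, so one exchange with one sign remains. The minus stays inside the argument
    of \<open>A\<close>, hence the instance at \<open>- u\<close>.\<close>
  have 3: "b (A u) v = - b (A v) u" for u v
  proof -
    have "b (A u) v = b (A (J 2 (J 1 u))) (J 2 (J 1 v))"
      using 2[of u v 1] 2[of "J 1 v" "J 1 u" 2] by simp
    also have "\<dots> = - b (A v) u"
      using 2[of v "- u" 3] by (simp add: J2_J1 J_simps b_simps)
    finally show ?thesis .
  qed
  show "b (A u) v = - b u (A v)" using 3[of u v] inner_product_commute[OF ip] by metis
  show "A (J j u) = J j (A u)"
  proof (rule inner_product_eqI[OF ip])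
    fix w show "b (A (J j u)) w = b (J j (A u)) w"
      using 1[of u j w] 3[of "J j u" w] by (simp add: b_J_left)
  qed
qed

text \<open>The core of the argument at a single point, with \<open>A e\<close> in the role of the
  covariant derivative of \<open>V e\<close>. The assumptions i, ii and iii are the derivatives of
  three relations: \<open>V e\<close> is orthogonal to \<open>V e'\<close>, \<open>J 1 (V e)\<close>
  is orthogonal to \<open>V e'\<close>, and all \<open>V e\<close> have the same length.\<close>

lemma moment_frame_parallel:
  assumes E: "\<And>e. e \<in> E \<Longrightarrow> \<exists>e'\<in>E. e' \<noteq> e"
    and lin: "\<And>e. e \<in> E \<Longrightarrow> linear (A e)"
    and sym: "\<And>e j u v. e \<in> E \<Longrightarrow> b (J j (A e u)) v = b (J j (A e v)) u"
    and i: "\<And>e e' u. e \<in> E \<Longrightarrow> e' \<in> E \<Longrightarrow> e \<noteq> e' \<Longrightarrow> b (A e u) (V e') + b (V e) (A e' u) = 0"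
    and ii: "\<And>e e' u. e \<in> E \<Longrightarrow> e' \<in> E \<Longrightarrow> b (J 1 (A e u)) (V e') + b (J 1 (V e)) (A e' u) = 0"
    and iii: "\<And>e e' u. e \<in> E \<Longrightarrow> e' \<in> E \<Longrightarrow> b (A e u) (V e) = b (A e' u) (V e')"
    and span: "span ((\<Union>e\<in>E. insert (V e) (range (\<lambda>j. J j (V e))))) = UNIV"
    and e: "e \<in> E"
  shows "A e u = 0"
proof -
  note skew = skew_commuting(1)[OF sym] and comm = skew_commuting(2)[OF sym]
  have swap: "A e (V e') = A e' (V e)" if "e \<in> E" "e' \<in> E" for e e'
  proof -
    \<comment> \<open>In ii, the symmetry of \<open>J 1\<close> composed with \<open>A e\<close>
      frees \<open>u\<close> in the first term; skewness of \<open>A e'\<close> and its commuting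
      with \<open>J 1\<close> free it in the second.\<close>
    have "b (J 1 (A e (V e'))) u = b (J 1 (A e' (V e))) u" for u
    proof -
      have "b (J 1 (A e u)) (V e') = b (J 1 (A e (V e'))) u"
        by (rule sym[OF that(1)])
      moreover have "b (J 1 (V e)) (A e' u) = - b (J 1 (A e' (V e))) u"
        using skew[OF that(2), of u "J 1 (V e)"] comm[OF that(2), of 1 "V e"]
          inner_product_commute[OF ip, of "J 1 (V e)" "A e' u"]
          inner_product_commute[OF ip, of u "J 1 (A e' (V e))"] by simp
      ultimately show ?thesis using ii[OF that, of u] by simp
    qed
    then have "J 1 (A e (V e')) = J 1 (A e' (V e))" by (rule inner_product_eqI[OF ip])
    then have "J 1 (J 1 (A e (V e'))) = J 1 (J 1 (A e' (V e)))" by simp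
    then show ?thesis by (simp add: J_square)
  qed
  have off: "A e (V e') = 0" if "e \<in> E" "e' \<in> E" "e \<noteq> e'" for e e'
  proof (rule inner_product_eqI[OF ip])
    fix u
    have "b (A e u) (V e') = - b (A e (V e')) u"
      using skew[OF that(1), of u "V e'"] inner_product_commute[OF ip, of u "A e (V e')"] by simp
    moreover have "b (V e) (A e' u) = - b (A e' (V e)) u"
      using skew[OF that(2), of "V e" u] by simp
    ultimately show "b (A e (V e')) u = b 0 u"
      using i[OF that, of u] swap[OF that(1,2)] by (simp add: b_simps)
  qed
  have h: "b (A e u) (V e) = 0" if e: "e \<in> E" for e u
  proof -
    have "linear (\<lambda>u. b (A e u) (V e))"
      using linear_compose[OF lin[OF e] inner_product_linear(2)[OF ip]] by (simp add: o_def)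
    moreover have "b (A e w) (V e) = 0" if w: "w \<in> (\<Union>e\<in>E. insert (V e) (range (\<lambda>j. J j (V e))))" for w
    proof -
      obtain d where d: "d \<in> E" "w = V d \<or> (\<exists>j. w = J j (V d))" using w by auto
      \<comment> \<open>By iii the derivative of the length along \<open>w\<close> may be computed
        with any element of \<open>E\<close>. One different from \<open>d\<close> is the right
        choice, because \<open>A d'\<close> kills \<open>V d\<close> and its images under the
        complex structures.\<close>
      obtain d' where d': "d' \<in> E" "d' \<noteq> d" using E[OF d(1)] by blast
      have "A d' w = 0" using off[OF d'(1) d(1) d'(2)] d(2) comm[OF d'(1)] by (auto simp: J_simps)
      then show ?thesis using iii[OF e d'(1), of w] by (simp add: b_simps)
    qed
    moreover have "u \<in> span (\<Union>e\<in>E. insert (V e) (range (\<lambda>j. J j (V e))))" using span by simp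
    ultimately show ?thesis
      using linear_eq_0_on_span[of "\<lambda>u. b (A e u) (V e)" "\<Union>e\<in>E. insert (V e) (range (\<lambda>j. J j (V e)))" u] by blast
  qed
  have diag: "A e (V e') = 0" if "e \<in> E" "e' \<in> E" for e e'
  proof (cases "e = e'")
    case True
    show ?thesis
    proof (rule inner_product_eqI[OF ip])
      fix u show "b (A e (V e')) u = b 0 u"
        using h[OF that(1), of u] skew[OF that(1), of "V e" u] True
          inner_product_commute[OF ip, of "V e" "A e u"] by (simp add: b_simps)
    qed
  qed (use off that in blast)
  have "A e w = 0" if "w \<in> (\<Union>e\<in>E. insert (V e) (range (\<lambda>j. J j (V e))))" for w
    using that diag[OF e] comm[OF e] by (auto simp: J_simps)
  then show ?thesis using linear_eq_0_on_span[OF lin[OF e]] span by blast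
qed

end

section \<open>Hyper-Kaehler geometry on an open subset of a Euclidean space\<close>

text \<open>The image of a chart with the metric read in coordinates. Two is the number of
  derivatives of the metric that enter the curvature.\<close>

locale local_metric =
  fixes S :: "'e::euclidean_space set" and G :: "'e \<Rightarrow> 'e \<Rightarrow> 'e \<Rightarrow> real"
  assumes open_S: "open S" and ip_G: "y \<in> S \<Longrightarrow> inner_product (G y)"
    and C_k_G: "C_k_on 2 S (\<lambda>y. G y u v)"
begin

abbreviation dG :: "'e \<Rightarrow> 'e \<Rightarrow> 'e \<Rightarrow> 'e \<Rightarrow> real" where
  "dG y u v w \<equiv> frechet_derivative (\<lambda>y. G y v w) (at y) u"

section \<open>The Koszul formula and Christoffel symbols\<close>

lemma has_derivative_G: "y \<in> S \<Longrightarrow> ((\<lambda>y. G y v w) has_derivative (\<lambda>u. dG y u v w)) (at y)"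
  using C_k_on_SucE[OF C_k_G[unfolded numeral_2_eq_2]] .

lemma dG_commute: "y \<in> S \<Longrightarrow> dG y u v w = dG y u w v"
  by (rule fun_cong[OF frechet_derivative_transform_within_open[OF _ open_S]])
    (auto intro: inner_product_commute ip_G differentiableI has_derivative_G)

lemma linear_dG:
  assumes y: "y \<in> S"
  shows "linear (dG y u v)" "linear (\<lambda>u. dG y u v w)"
proof -
  show "linear (\<lambda>u. dG y u v w)" using has_derivative_linear[OF has_derivative_G[OF y]] .
  show "linear (dG y u v)"
  proof (rule linearI)
    fix w w' :: 'e and c :: real
    have "((\<lambda>y. G y v (w + w')) has_derivative (\<lambda>u. dG y u v w + dG y u v w')) (at y)"
      by (rule has_derivative_transform_within_open[OF has_derivative_add[OF
              has_derivative_G[OF y] has_derivative_G[OF y]] open_S y])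
        (simp add: inner_product_simps[OF ip_G])
    from frechet_derivative_eqI[OF this] show "dG y u v (w + w') = dG y u v w + dG y u v w'" by simp
    have "((\<lambda>y. G y v (c *\<^sub>R w)) has_derivative (\<lambda>u. c * dG y u v w)) (at y)"
      by (rule has_derivative_transform_within_open[OF has_derivative_mult_right[OF
              has_derivative_G[OF y]] open_S y])
        (simp add: inner_product_simps[OF ip_G])
    from frechet_derivative_eqI[OF this] show "dG y u v (c *\<^sub>R w) = c *\<^sub>R dG y u v w" by simp
  qed
qed

text \<open>The right-hand side is linear in \<open>w\<close>, so exactly one vector represents it,
  and the definite description in \<open>christoffel\<close> denotes that vector.\<close>

lemma christoffel:
  assumes y: "y \<in> S"
  shows "2 * G y (christoffel G y u v) w = dG y u v w + dG y v u w - dG y w u v"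
proof -
  have "linear (\<lambda>w. (dG y u v w + dG y v u w - dG y w u v) / 2)"
    by (rule linearI)
      (simp_all add: linear_add[OF linear_dG(1)[OF y]] linear_add[OF linear_dG(2)[OF y]]
        linear_cmul[OF linear_dG(1)[OF y]] linear_cmul[OF linear_dG(2)[OF y]] field_simps)
  from inner_product_representation[OF ip_G[OF y] this]
  have "\<exists>!z. \<forall>w. 2 * G y z w = dG y u v w + dG y v u w - dG y w u v"
    by (simp add: eq_divide_eq mult.commute)
  from theI'[OF this] show ?thesis unfolding christoffel_def by blast
qed

lemma christoffel_commute:
  assumes "y \<in> S"
  shows "christoffel G y u v = christoffel G y v u"
proof (rule inner_product_eqI[OF ip_G[OF assms]])
  show "G y (christoffel G y u v) w = G y (christoffel G y v u) w" for w
    using christoffel[OF assms, of u v w] christoffel[OF assms, of v u w]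
      dG_commute[OF assms, where u = w and v = u and w = v] by simp
qed

lemma linear_christoffel:
  assumes y: "y \<in> S"
  shows "linear (\<lambda>u. christoffel G y u v)"
proof -
  note b = inner_product_simps[OF ip_G[OF y]]
  have c: "G y (christoffel G y u v) w = (dG y u v w + dG y v u w - dG y w u v) / 2" for u w
    using christoffel[OF y, of u v w] by simp
  have d: "dG y x u w = dG y x w u" for x u w by (rule dG_commute[OF y])
  show ?thesis
    by (rule linearI; rule inner_product_eqI[OF ip_G[OF y]])
      (simp_all add: b c linear_add[OF linear_dG(2)[OF y]] linear_add[OF linear_dG(1)[OF y]]
        linear_cmul[OF linear_dG(2)[OF y]] linear_cmul[OF linear_dG(1)[OF y]]
        d[of _ "_ + _"] d[of _ "_ *\<^sub>R _"] d algebra_simps add_divide_distrib diff_divide_distrib)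
qed

section \<open>The Levi-Civita covariant derivative of vector fields\<close>

definition nabla :: "'e \<Rightarrow> 'e \<Rightarrow> ('e \<Rightarrow> 'e) \<Rightarrow> 'e" where
  "nabla y u Z = frechet_derivative Z (at y) u + christoffel G y u (Z y)"

lemma nabla_const: "nabla y u (\<lambda>_. v) = christoffel G y u v"
  by (simp add: nabla_def)

lemma linear_nabla:
  assumes "y \<in> S" "Z differentiable (at y)"
  shows "linear (\<lambda>u. nabla y u Z)"
  unfolding nabla_def
  using linear_compose_add[OF linear_frechet_derivative[OF assms(2)] linear_christoffel[OF assms(1)]] .

text \<open>Compatibility of the connection with the metric. Adding the Koszul formulas for
  \<open>Z y\<close>, \<open>W y\<close> in both orders cancels everything but the derivative of
  \<open>G\<close> along \<open>u\<close>.\<close>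

lemma has_derivative_metric:
  assumes y: "y \<in> S" and Z: "Z differentiable (at y)" and W: "W differentiable (at y)"
  shows "((\<lambda>y. G y (Z y) (W y)) has_derivative
    (\<lambda>u. G y (nabla y u Z) (W y) + G y (Z y) (nabla y u W))) (at y)"
proof -
  note b = inner_product_simps[OF ip_G[OF y]]
  note Z' = differentiable_has_derivative[OF Z] and W' = differentiable_has_derivative[OF W]
  \<comment> \<open>The product rule is applied to one argument at a time, here with the second one
    frozen.\<close>
  have 1: "((\<lambda>y. G y (Z y) w) has_derivative
      (\<lambda>u. dG y u (Z y) w + G y (frechet_derivative Z (at y) u) w)) (at y)" for w
    by (rule has_derivative_linear_family[OF open_S y, of "\<lambda>y z. G y z w"])
      (use Z' has_derivative_G[OF y] in \<open>auto intro: inner_product_linear(2)[OF ip_G] differentiableI\<close>)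
  have "((\<lambda>y. G y (Z y) (W y)) has_derivative
      (\<lambda>u. frechet_derivative (\<lambda>y'. G y' (Z y') (W y)) (at y) u
         + G y (Z y) (frechet_derivative W (at y) u))) (at y)"
    by (rule has_derivative_linear_family[OF open_S y, of "\<lambda>y. G y (Z y)"])
      (use W' 1 in \<open>auto intro: inner_product_linear(1)[OF ip_G] differentiableI\<close>)
  moreover have "dG y u (Z y) (W y) = G y (christoffel G y u (Z y)) (W y) + G y (Z y) (christoffel G y u (W y))" for u
    using christoffel[OF y, of u "Z y" "W y"] christoffel[OF y, of u "W y" "Z y"]
      inner_product_commute[OF ip_G[OF y], of "Z y" "christoffel G y u (W y)"]
      dG_commute[OF y, where v = "Z y" and w = "W y"] dG_commute[OF y, where v = u] by simp
  ultimately show ?thesis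
    by (simp add: frechet_derivative_eqI[OF 1] nabla_def b algebra_simps)
qed

text \<open>The covariant Hessian of a function is symmetric, because second derivatives commute and
  the connection has no torsion.\<close>

lemma gradient_symmetric:
  assumes \<psi>: "C_k_on 2 S \<psi>" and y: "y \<in> S" and P: "P differentiable (at y)"
    and grad: "\<And>y v. y \<in> S \<Longrightarrow> G y (P y) v = frechet_derivative \<psi> (at y) v"
  shows "G y (nabla y u P) v = G y (nabla y v P) u"
proof -
  have 1: "frechet_derivative (\<lambda>y. frechet_derivative \<psi> (at y) v) (at y) u
      = G y (nabla y u P) v + G y (P y) (christoffel G y u v)" for u v
  proof -
    have "((\<lambda>y. frechet_derivative \<psi> (at y) v) has_derivative
        (\<lambda>u. G y (nabla y u P) v + G y (P y) (nabla y u (\<lambda>_. v)))) (at y)"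
      by (rule has_derivative_transform_within_open[OF has_derivative_metric[OF y P] open_S y])
        (auto simp: grad)
    from frechet_derivative_eqI[OF this] show ?thesis by (simp add: nabla_const)
  qed
  have "frechet_derivative (\<lambda>y. frechet_derivative \<psi> (at y) v) (at y) u
      = frechet_derivative (\<lambda>y. frechet_derivative \<psi> (at y) u) (at y) v"
    by (rule symmetric_second_frechet_derivative[OF open_S y \<psi>])
  then show ?thesis using 1[of v u] 1[of u v] christoffel_commute[OF y, of u v] by simp
qed

text \<open>Let \<alpha> be the product of a constant field \<open>w\<close> with a parallel
  \<open>P k\<close>. The component of the covariant derivative of \<open>w\<close> along
  \<open>P k\<close> is then just the derivative of \<alpha>, so the components of the curvature are
  commutators of second derivatives of \<alpha>.\<close>

lemma curvature_eq_0_if_parallel_frame: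
  fixes P :: "'i \<Rightarrow> 'e \<Rightarrow> 'e"
  assumes K: "finite K" "card K = DIM('e)" and f: "f \<noteq> 0"
    and P: "\<And>k. k \<in> K \<Longrightarrow> C_k_on 2 S (P k)"
    and orth: "\<And>k l y. k \<in> K \<Longrightarrow> l \<in> K \<Longrightarrow> y \<in> S \<Longrightarrow> G y (P k y) (P l y) = (if k = l then f else 0)"
    and par: "\<And>k y u. k \<in> K \<Longrightarrow> y \<in> S \<Longrightarrow> nabla y u (P k) = 0"
    and y: "y \<in> S"
  shows "curvature G y u v w = 0"
proof -
  define \<alpha> where "\<alpha> k w y = G y w (P k y)" for k w y
  have dP: "P k differentiable (at y)" if "k \<in> K" "y \<in> S" for k y
    using P[OF that(1)] that(2) by (auto simp: numeral_2_eq_2)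
  have C\<alpha>: "C_k_on 2 S (\<alpha> k w)" if "k \<in> K" for k w
    unfolding \<alpha>_def
    by (rule C_k_on_linear_family[OF open_S _ C_k_G P[OF that]]) (rule inner_product_linear(1)[OF ip_G])
  have \<Gamma>: "G y (christoffel G y v w) (P k y) = frechet_derivative (\<alpha> k w) (at y) v"
    if "k \<in> K" "y \<in> S" for k y v w
  proof -
    have "(\<alpha> k w has_derivative (\<lambda>v. G y (nabla y v (\<lambda>_. w)) (P k y) + G y w (nabla y v (P k)))) (at y)"
      unfolding \<alpha>_def by (rule has_derivative_metric[OF that(2) _ dP[OF that]]) simp
    from frechet_derivative_eqI[OF this] show ?thesis
      by (simp add: nabla_const par[OF that] inner_product_simps[OF ip_G[OF that(2)]])
  qed
  \<comment> \<open>Since \<open>christoffel\<close> is given by a description, its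
    differentiability is read off its expansion in the frame, whose coefficients are first
    derivatives of twice differentiable functions.\<close>
  have d\<Gamma>: "(\<lambda>y. christoffel G y v w) differentiable (at y)" for v w
  proof (rule differentiable_transform_within_open[OF _ open_S y])
    show "(\<lambda>y. \<Sum>k\<in>K. (frechet_derivative (\<alpha> k w) (at y) v / f) *\<^sub>R P k y) differentiable (at y)"
    proof (intro differentiable_sum K differentiable_scaleR dP y ballI)
      fix k assume "k \<in> K"
      from C\<alpha>[OF this, of w] have "(\<lambda>y. frechet_derivative (\<alpha> k w) (at y) v) differentiable (at y)"
        using y by (auto simp: numeral_2_eq_2)
      then show "(\<lambda>y. frechet_derivative (\<alpha> k w) (at y) v / f) differentiable (at y)"
        using f by (auto intro!: differentiable_divide)
    qed
    show "(\<Sum>k\<in>K. (frechet_derivative (\<alpha> k w) (at y) v / f) *\<^sub>R P k y) = christoffel G y v w"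
      if "y \<in> S" for y
      using orthogonal_frame_expansion(2)[OF ip_G[OF that] f K, of "\<lambda>k. P k y" "christoffel G y v w"]
        orth that by (simp add: \<Gamma> cong: sum.cong)
  qed
  have D: "G y (nabla y u (\<lambda>y. christoffel G y v w)) (P k y)
      = frechet_derivative (\<lambda>y. frechet_derivative (\<alpha> k w) (at y) v) (at y) u"
    if k: "k \<in> K" for k u v
  proof -
    have "((\<lambda>y. frechet_derivative (\<alpha> k w) (at y) v) has_derivative
        (\<lambda>u. G y (nabla y u (\<lambda>y. christoffel G y v w)) (P k y)
           + G y (christoffel G y v w) (nabla y u (P k)))) (at y)"
      by (rule has_derivative_transform_within_open[OF has_derivative_metric[OF y d\<Gamma> dP[OF k y]] open_S y])
        (simp add: \<Gamma>[OF k])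
    from frechet_derivative_eqI[OF this] show ?thesis
      by (simp add: par[OF k y] inner_product_simps[OF ip_G[OF y]])
  qed
  have curv: "curvature G y u v w
      = nabla y u (\<lambda>y. christoffel G y v w) - nabla y v (\<lambda>y. christoffel G y u w)"
    by (simp add: curvature_def nabla_def)
  have "G y (curvature G y u v w) (P k y) = 0" if "k \<in> K" for k
    unfolding curv inner_product_simps[OF ip_G[OF y]] D[OF that]
    using symmetric_second_frechet_derivative[OF open_S y C\<alpha>[OF that], of w v u] by simp
  then show ?thesis
    using orthogonal_frame_expansion(2)[OF ip_G[OF y] f K, of "\<lambda>k. P k y" "curvature G y u v w"]
      orth y by simp
qed

end

locale local_hyper_kaehler = local_metric S G
  for S :: "'e::euclidean_space set" and G :: "'e \<Rightarrow> 'e \<Rightarrow> 'e \<Rightarrow> real" +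
  fixes J :: "3 \<Rightarrow> 'e \<Rightarrow> 'e \<Rightarrow> 'e"
  assumes hyper_hermitian: "y \<in> S \<Longrightarrow> hyper_hermitian (G y) (\<lambda>j. J j y)"
    and C_k_J: "C_k_on 2 S (\<lambda>y. J j y u)"
    and parallel_J: "y \<in> S \<Longrightarrow> frechet_derivative (\<lambda>y. J j y v) (at y) u
       + christoffel G y u (J j y v) = J j y (christoffel G y u v)"
begin

lemma linear_J: "y \<in> S \<Longrightarrow> linear (J j y)"
  using hyper_hermitian.linear_J[OF hyper_hermitian] .

lemma C_k_J_field: "C_k_on 2 S Z \<Longrightarrow> C_k_on 2 S (\<lambda>y. J j y (Z y))"
  by (rule C_k_on_linear_family[OF open_S linear_J C_k_J])

text \<open>The assumption \<open>parallel_J\<close> concerns constant vectors; the product rule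
  extends it to vector fields.\<close>

lemma nabla_J:
  assumes y: "y \<in> S" and Z: "Z differentiable (at y)"
  shows "nabla y u (\<lambda>y. J j y (Z y)) = J j y (nabla y u Z)"
proof -
  have "(\<lambda>y. J j y v) differentiable (at y)" for v
    using C_k_J[of j v] y by (auto simp: numeral_2_eq_2)
  from frechet_derivative_eqI[OF has_derivative_linear_family[OF open_S y linear_J this
        differentiable_has_derivative[OF Z]]]
  show ?thesis
    using parallel_J[OF y, of j "Z y" u]
    by (simp add: nabla_def linear_add[OF linear_J[OF y]] algebra_simps)
qed

end

text \<open>The situation of the theorem in one chart: \<open>E\<close> is an orthonormal basis of
  the Lie algebra, \<open>V e\<close> a fundamental field, \<open>\<psi> e j\<close> a component of
  the moment map and \<open>f\<close> the common squared length. No regularity of \<open>f\<close>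
  is assumed and it may have zeros.\<close>

locale local_conformal_moment = local_hyper_kaehler S G J
  for S :: "'e::euclidean_space set" and G :: "'e \<Rightarrow> 'e \<Rightarrow> 'e \<Rightarrow> real" and J :: "3 \<Rightarrow> 'e \<Rightarrow> 'e \<Rightarrow> 'e" +
  fixes E :: "'i set" and V :: "'i \<Rightarrow> 'e \<Rightarrow> 'e" and \<psi> :: "'i \<Rightarrow> 3 \<Rightarrow> 'e \<Rightarrow> real" and f :: "'e \<Rightarrow> real"
  assumes E: "finite E" "card E \<ge> 2" "4 * card E = DIM('e)"
    and C_k_V: "e \<in> E \<Longrightarrow> C_k_on 2 S (V e)" and C_k_\<psi>: "e \<in> E \<Longrightarrow> C_k_on 2 S (\<psi> e j)"
    and gradient: "e \<in> E \<Longrightarrow> y \<in> S \<Longrightarrow> G y (J j y (V e y)) v = frechet_derivative (\<psi> e j) (at y) v"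
    and conformal: "e \<in> E \<Longrightarrow> e' \<in> E \<Longrightarrow> y \<in> S \<Longrightarrow>
      G y (J i y (V e y)) (J j y (V e' y)) = (if i = j \<and> e = e' then f y else 0)"
begin

text \<open>The four elements of \<open>3 option\<close> play the part of the quaternion units, with
  \<open>None\<close> for the real unit.\<close>

definition frame :: "'i \<times> 3 option \<Rightarrow> 'e \<Rightarrow> 'e" where
  "frame k y = (case snd k of None \<Rightarrow> V (fst k) y | Some j \<Rightarrow> J j y (V (fst k) y))"

abbreviation "indices \<equiv> E \<times> (UNIV :: 3 option set)"

lemma indices: "finite indices" "card indices = DIM('e)"
  using E by (simp_all add: card_cartesian_product card_UNIV_option)

lemma differentiable_V: "e \<in> E \<Longrightarrow> y \<in> S \<Longrightarrow> V e differentiable (at y)"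
  using C_k_V[of e] by (auto simp: numeral_2_eq_2)

lemma V_V: "e \<in> E \<Longrightarrow> e' \<in> E \<Longrightarrow> y \<in> S \<Longrightarrow> G y (V e y) (V e' y) = (if e = e' then f y else 0)"
  using conformal[of e e' y 1 1] hyper_hermitian.hermitian[OF hyper_hermitian, of y 1] by simp

lemma JV_V: "e \<in> E \<Longrightarrow> e' \<in> E \<Longrightarrow> y \<in> S \<Longrightarrow> G y (J j y (V e y)) (V e' y) = 0"
  by (rule hyper_hermitian.b_J_orthogonal[OF hyper_hermitian, of y _ _ "if e = e' then f y else 0"])
    (auto simp: conformal)

lemma frame_orthogonal:
  assumes "k \<in> indices" "l \<in> indices" "y \<in> S"
  shows "G y (frame k y) (frame l y) = (if k = l then f y else 0)"
proof -
  obtain e p e' p' where k: "k = (e, p)" "l = (e', p')" "e \<in> E" "e' \<in> E" using assms by auto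
  then show ?thesis
    using conformal[OF k(3,4) assms(3)] V_V[OF k(3,4) assms(3)] JV_V[OF k(3,4) assms(3)]
      JV_V[OF k(4,3) assms(3)] inner_product_commute[OF ip_G[OF assms(3)], of "V e y"]
    by (cases p; cases p') (auto simp: frame_def)
qed

text \<open>Where \<open>f\<close> is nonzero the orthogonal frame spans, so the pointwise algebra
  applies to the derivatives of the orthogonality relations.\<close>

lemma nabla_V_eq_0:
  assumes y: "y \<in> S" and f: "f y \<noteq> 0" and e: "e \<in> E"
  shows "nabla y u (V e) = 0"
proof -
  interpret H: hyper_hermitian "G y" "\<lambda>j. J j y" by (rule hyper_hermitian[OF y])
  \<comment> \<open>Turns a relation between vector fields that holds throughout \<open>S\<close>
    into one between their covariant derivatives, by uniqueness of the derivative.\<close>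
  have deriv: "G y (nabla y u Z) (W y) + G y (Z y) (nabla y u W) = F u"
    if "\<And>y. y \<in> S \<Longrightarrow> G y (Z y) (W y) = h y" "Z differentiable (at y)" "W differentiable (at y)"
      "(h has_derivative F) (at y)" for Z W h F u
  proof -
    have "(h has_derivative (\<lambda>u. G y (nabla y u Z) (W y) + G y (Z y) (nabla y u W))) (at y)"
      by (rule has_derivative_transform_within_open[OF has_derivative_metric[OF y that(2,3)] open_S y])
        (rule that(1))
    from has_derivative_unique[OF this that(4)] show ?thesis by metis
  qed
  have dJV: "(\<lambda>y. J j y (V e y)) differentiable (at y)" if "e \<in> E" for j e
    using C_k_J_field[OF C_k_V[OF that], of j] y by (auto simp: numeral_2_eq_2)
  note dV = differentiable_V[OF _ y]
  have span: "span (\<Union>e\<in>E. insert (V e y) (range (\<lambda>j. J j y (V e y)))) = UNIV"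
  proof -
    have "(\<lambda>k. frame k y) ` indices \<subseteq> (\<Union>e\<in>E. insert (V e y) (range (\<lambda>j. J j y (V e y))))"
      by (auto simp: frame_def split: option.splits)
    from span_mono[OF this] show ?thesis
      using orthogonal_frame_expansion(1)[OF ip_G[OF y] f indices, of "\<lambda>k. frame k y"]
        frame_orthogonal[OF _ _ y] by auto
  qed
  show ?thesis
  proof (rule H.moment_frame_parallel[where A = "\<lambda>e u. nabla y u (V e)" and V = "\<lambda>e. V e y", OF _ _ _ _ _ _ span e])
    show "\<exists>e'\<in>E. e' \<noteq> e" if "e \<in> E" for e
    proof (rule ccontr)
      assume "\<not> ?thesis"
      then have "E \<subseteq> {e}" by blast
      from card_mono[OF _ this] E(2) show False by simp
    qed
    show "linear (\<lambda>u. nabla y u (V e))" if "e \<in> E" for e by (rule linear_nabla[OF y dV[OF that]])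
    show "G y (J j y (nabla y u (V e))) v = G y (J j y (nabla y v (V e))) u" if "e \<in> E" for e j u v
      using gradient_symmetric[OF C_k_\<psi>[OF that] y dJV[OF that, of j] gradient[OF that], where u = u and v = v]
      by (simp add: nabla_J[OF y dV[OF that]])
    show "G y (nabla y u (V e)) (V e' y) + G y (V e y) (nabla y u (V e')) = 0"
      if "e \<in> E" "e' \<in> E" "e \<noteq> e'" for e e' u
      by (rule deriv[of "V e" "V e'" "\<lambda>_. 0" "\<lambda>_. 0"]) (use that dV V_V in auto)
    show "G y (J 1 y (nabla y u (V e))) (V e' y) + G y (J 1 y (V e y)) (nabla y u (V e')) = 0"
      if "e \<in> E" "e' \<in> E" for e e' u
      unfolding nabla_J[OF y dV[OF that(1)], symmetric]
      by (rule deriv[of "\<lambda>y. J 1 y (V e y)" "V e'" "\<lambda>_. 0" "\<lambda>_. 0"]) (use that dV dJV JV_V in auto)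
    show "G y (nabla y u (V e)) (V e y) = G y (nabla y u (V e')) (V e' y)"
      if "e \<in> E" "e' \<in> E" for e e' u
    proof -
      \<comment> \<open>Both squared lengths equal \<open>f\<close> on \<open>S\<close>, so their
        derivatives agree; symmetry of the metric makes each side twice the wanted term.\<close>
      have "G y (nabla y u (V e)) (V e y) + G y (V e y) (nabla y u (V e))
          = G y (nabla y u (V e')) (V e' y) + G y (V e' y) (nabla y u (V e'))"
        by (rule deriv[OF _ _ _ has_derivative_metric[OF y dV dV]]) (use that dV V_V in auto)
      then show ?thesis using inner_product_commute[OF ip_G[OF y]] by (metis mult_2 mult_cancel_left zero_neq_numeral)
    qed
  qed
qed

text \<open>Differentiability comes from writing \<open>f\<close> as the squared length of some
  \<open>V e\<close>. Where \<open>f\<close> is nonzero \<open>V e\<close> has zero covariant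
  derivative; at a zero of \<open>f\<close> the vector \<open>V e y\<close> vanishes, and with it
  both terms of the product rule.\<close>

lemma has_derivative_factor_0:
  assumes y: "y \<in> S"
  shows "(f has_derivative (\<lambda>_. 0)) (at y)"
proof -
  obtain e where e: "e \<in> E" using E(2) by fastforce
  have "(f has_derivative (\<lambda>u. G y (nabla y u (V e)) (V e y) + G y (V e y) (nabla y u (V e)))) (at y)"
    by (rule has_derivative_transform_within_open[OF has_derivative_metric[OF y
            differentiable_V[OF e y] differentiable_V[OF e y]] open_S y])
      (simp add: V_V[OF e e])
  moreover have "V e y = 0" if "f y = 0"
    using V_V[OF e e y] that inner_product_eq_0[OF ip_G[OF y]] by simp
  ultimately show ?thesis
    using nabla_V_eq_0[OF y _ e] by (cases "f y = 0") (simp_all add: inner_product_simps[OF ip_G[OF y]])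
qed

lemma curvature_eq_0:
  assumes f: "\<And>y. y \<in> S \<Longrightarrow> f y = r" "r \<noteq> 0" and y: "y \<in> S"
  shows "curvature G y u v w = 0"
proof (rule curvature_eq_0_if_parallel_frame[OF indices f(2) _ _ _ y])
  fix k assume k: "k \<in> indices"
  then obtain e p where e: "k = (e, p)" "e \<in> E" by auto
  show "C_k_on 2 S (frame k)"
    using C_k_V[OF e(2)] C_k_J_field[OF C_k_V[OF e(2)]] e
    unfolding frame_def by (cases p) auto
  show "nabla y u (frame k) = 0" if y: "y \<in> S" for y u
  proof -
    have 0: "nabla y u (V e) = 0" using nabla_V_eq_0[OF y _ e(2)] f y by simp
    show ?thesis
      using 0 nabla_J[OF y differentiable_V[OF e(2) y]] linear_0[OF linear_J[OF y]] e
      unfolding frame_def by (cases p) auto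
  qed
  show "G y (frame k y) (frame l y) = (if k = l then r else 0)" if "l \<in> indices" "y \<in> S" for l y
    using frame_orthogonal[OF k that] f that by simp
qed

end

section \<open>Manifolds and actions in charts\<close>

text \<open>The chain rule in the form needed for coordinate expressions, which factor only where
  all charts involved are defined.\<close>

lemma frechet_derivative_compose_near:
  assumes f: "(f has_derivative f') (at (h x))" and h: "(h has_derivative h') (at x)"
    and U: "open U" "x \<in> U" "\<And>y. y \<in> U \<Longrightarrow> k y = f (h y)"
  shows "(k has_derivative (\<lambda>u. f' (h' u))) (at x)"
  by (rule has_derivative_transform_within_open[OF diff_chain_at[OF h f, unfolded o_def] U(1,2)])
    (simp add: U(3))

lemma smooth_on_differentiable: "smooth_on S f \<Longrightarrow> x \<in> S \<Longrightarrow> f differentiable (at x)"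
  unfolding smooth_on_def by (metis C_k_on.simps(2))

section \<open>Charts and changes of coordinates\<close>

context smooth_manifold
begin

lemma chart_inv_chart [simp]: "c \<in> A \<Longrightarrow> x \<in> fst c \<Longrightarrow> chart_inv c (snd c x) = x"
  and chart_chart_inv [simp]: "c \<in> A \<Longrightarrow> y \<in> chart_image c \<Longrightarrow> snd c (chart_inv c y) = y"
  and chart_inv_in_domain: "c \<in> A \<Longrightarrow> y \<in> chart_image c \<Longrightarrow> chart_inv c y \<in> fst c"
  and continuous_on_chart: "c \<in> A \<Longrightarrow> continuous_on (fst c) (snd c)"
  and continuous_on_chart_inv: "c \<in> A \<Longrightarrow> continuous_on (chart_image c) (chart_inv c)"
  using chart_homeomorphism[of c] unfolding homeomorphism_def by auto

lemma chart_in_image: "x \<in> fst c \<Longrightarrow> snd c x \<in> chart_image c"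
  by (simp add: chart_image_def)

lemma chart_at: "chart_at A x \<in> A" "x \<in> fst (chart_at A x)"
proof -
  have "\<exists>c. c \<in> A \<and> x \<in> fst c" using covering by blast
  from someI_ex[OF this] show "chart_at A x \<in> A" "x \<in> fst (chart_at A x)"
    unfolding chart_at_def by auto
qed

lemma open_chart_inv_vimage:
  assumes "c \<in> A" "open U"
  shows "open (chart_image c \<inter> chart_inv c -` U)"
  by (rule continuous_open_preimage[OF continuous_on_chart_inv[OF assms(1)] open_image[OF assms(1)] assms(2)])

lemma open_chart_inv_image:
  assumes "c \<in> A" "open W" "W \<subseteq> chart_image c"
  shows "open (chart_inv c ` W)"
proof -
  have "chart_inv c ` W = fst c \<inter> snd c -` W"
  proof (intro subset_antisym subsetI)
    fix x assume "x \<in> chart_inv c ` W"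
    then show "x \<in> fst c \<inter> snd c -` W"
      using assms(1,3) chart_inv_in_domain[OF assms(1)] chart_chart_inv[OF assms(1)] by blast
  next
    fix x assume "x \<in> fst c \<inter> snd c -` W"
    then show "x \<in> chart_inv c ` W"
      using chart_inv_chart[OF assms(1), of x] by (metis IntE image_eqI vimageE)
  qed
  then show ?thesis
    using continuous_open_preimage[OF continuous_on_chart[OF assms(1)] open_domain[OF assms(1)] assms(2)]
    by simp
qed

lemma has_derivative_transition:
  assumes "c \<in> A" "d \<in> A" "x \<in> fst c" "x \<in> fst d"
  shows "(snd d \<circ> chart_inv c has_derivative frechet_derivative (snd d \<circ> chart_inv c) (at (snd c x)))
    (at (snd c x))"
  by (rule differentiable_has_derivative[OF smooth_on_differentiable[OF smooth_transition[OF assms(1,2)]]])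
    (use assms in auto)

lemma has_derivative_change_chart:
  assumes c: "c \<in> A" "x \<in> fst c" and d: "d \<in> A" "x \<in> fst d"
    and f: "(f \<circ> chart_inv d has_derivative f') (at (snd d x))"
  shows "(f \<circ> chart_inv c has_derivative
    (\<lambda>u. f' (frechet_derivative (snd d \<circ> chart_inv c) (at (snd c x)) u))) (at (snd c x))"
proof (rule frechet_derivative_compose_near[OF _ has_derivative_transition[OF c(1) d(1) c(2) d(2)]])
  show "(f \<circ> chart_inv d has_derivative f') (at ((snd d \<circ> chart_inv c) (snd c x)))"
    using f c by simp
  show "open (chart_image c \<inter> chart_inv c -` fst d)"
    by (rule open_chart_inv_vimage[OF c(1) open_domain[OF d(1)]])
qed (simp_all add: c d chart_in_image)

lemma
  assumes "c \<in> A" "x \<in> fst c"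
  shows has_derivative_from_coords:
      "(snd (chart_at A x) \<circ> chart_inv c has_derivative from_coords A c x) (at (snd c x))"
    and has_derivative_to_coords:
      "(snd c \<circ> chart_inv (chart_at A x) has_derivative to_coords A c x)
        (at (snd (chart_at A x) x))"
  unfolding from_coords_def to_coords_def
  using has_derivative_transition[OF assms(1) chart_at(1)[of x] assms(2) chart_at(2)]
    has_derivative_transition[OF chart_at(1)[of x] assms(1) chart_at(2) assms(2)] by auto

lemma has_derivative_in_chart:
  assumes "c \<in> A" "x \<in> fst c" "(f \<circ> chart_inv (chart_at A x) has_derivative f') (at (snd (chart_at A x) x))"
  shows "(f \<circ> chart_inv c has_derivative (\<lambda>u. f' (from_coords A c x u))) (at (snd c x))"
  using has_derivative_change_chart[OF assms(1,2) chart_at assms(3)] by (simp add: from_coords_def)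

lemma linear_from_coords: "c \<in> A \<Longrightarrow> x \<in> fst c \<Longrightarrow> linear (from_coords A c x)"
  and linear_to_coords: "c \<in> A \<Longrightarrow> x \<in> fst c \<Longrightarrow> linear (to_coords A c x)"
  using has_derivative_from_coords has_derivative_to_coords has_derivative_linear by blast+

lemma has_derivative_chart_chart_inv:
  assumes "c \<in> A" "x \<in> fst c"
  shows "(snd c \<circ> chart_inv c has_derivative (\<lambda>u. u)) (at (snd c x))"
  by (rule has_derivative_transform_within_open[OF has_derivative_ident open_image[OF assms(1)]])
    (simp_all add: assms chart_in_image)

lemma to_from_coords [simp]:
  assumes "c \<in> A" "x \<in> fst c"
  shows "to_coords A c x (from_coords A c x u) = u"
  using has_derivative_unique[OF has_derivative_in_chart[OF assms has_derivative_to_coords[OF assms]]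
      has_derivative_chart_chart_inv[OF assms]] by metis

lemma from_to_coords [simp]:
  assumes "c \<in> A" "x \<in> fst c"
  shows "from_coords A c x (to_coords A c x u) = u"
  using has_derivative_unique[OF has_derivative_change_chart[OF chart_at assms has_derivative_from_coords[OF assms]]
      has_derivative_chart_chart_inv[OF chart_at]] unfolding to_coords_def by metis

text \<open>Coordinate balls are convex, so \<open>f\<close> is locally constant and every set
  \<open>{x. P (f x)}\<close> is open. Taking for \<open>P\<close> equality with \<open>f x'\<close>
  and its negation splits the connected space into two disjoint open sets.\<close>

lemma constant_if_chart_derivatives_0:
  fixes f :: "'m \<Rightarrow> real"
  assumes conn: "connected (UNIV :: 'm set)"
    and 0: "\<And>c y. c \<in> A \<Longrightarrow> y \<in> chart_image c \<Longrightarrow> (f \<circ> chart_inv c has_derivative (\<lambda>_. 0)) (at y)"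
  shows "f x = f x'"
proof -
  have op: "open {x. P (f x)}" for P
    unfolding open_subopen[of "{x. P (f x)}"]
  proof (intro ballI)
    fix x assume x: "x \<in> {x. P (f x)}"
    obtain c where c: "c \<in> A" "x \<in> fst c" using chart_at by blast
    obtain r where r: "r > 0" "ball (snd c x) r \<subseteq> chart_image c"
      using open_image[OF c(1)] chart_in_image[OF c(2)] open_contains_ball by blast
    have "(f \<circ> chart_inv c) y = f x" if "y \<in> ball (snd c x) r" for y
    proof -
      have "(f \<circ> chart_inv c) y = (f \<circ> chart_inv c) (snd c x)"
        by (rule has_derivative_zero_unique[OF convex_ball _ that, of _ "snd c x"])
          (use r in \<open>auto simp only: centre_in_ball intro!: has_derivative_at_withinI 0[OF c(1)]\<close>)
      then show ?thesis using c by simp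
    qed
    then show "\<exists>T. open T \<and> x \<in> T \<and> T \<subseteq> {x. P (f x)}"
      using x c r open_chart_inv_image[OF c(1) open_ball r(2)]
      by (intro exI[of _ "chart_inv c ` ball (snd c x) r"]) (auto intro!: image_eqI[of _ _ "snd c x"])
  qed
  have "{x. f x = f x'} \<inter> UNIV = {} \<or> {x. f x \<noteq> f x'} \<inter> UNIV = {}"
    by (rule connectedD[OF conn op[of "\<lambda>r. r = f x'"] op[of "\<lambda>r. r \<noteq> f x'"]]) auto
  then show ?thesis by blast
qed

end

section \<open>Maps into vector spaces\<close>

lemma differential_vector_space:
  "differential A vector_space_atlas f x
    = frechet_derivative (f \<circ> chart_inv (chart_at A x)) (at (snd (chart_at A x) x))"
proof -
  have "chart_at vector_space_atlas y = (UNIV, id)" for y :: 'b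
    unfolding chart_at_def vector_space_atlas_def by (rule some_equality) auto
  then show ?thesis by (simp add: differential_def comp_assoc)
qed

lemma smooth_map_vector_space:
  assumes "smooth_map A vector_space_atlas f" "c \<in> A"
  shows "smooth_on (chart_image c) (f \<circ> chart_inv c)"
  using assms by (auto simp: smooth_map_def vector_space_atlas_def chart_image_def)

lemma (in smooth_manifold) has_derivative_differential:
  assumes "smooth_map A vector_space_atlas f"
  shows "(f \<circ> chart_inv (chart_at A x) has_derivative differential A vector_space_atlas f x)
    (at (snd (chart_at A x) x))"
  unfolding differential_vector_space
  by (rule differentiable_has_derivative[OF smooth_on_differentiable[OF smooth_map_vector_space[OF assms chart_at(1)]]])
    (rule chart_in_image[OF chart_at(2)])

section \<open>Metric and complex structures in charts\<close>

context riemannian_manifold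
begin

lemma inner_product_form_in_chart:
  assumes "c \<in> A" "y \<in> chart_image c"
  shows "inner_product (form_in_chart A g c y)"
proof -
  let ?x = "chart_inv c y"
  have x: "?x \<in> fst c" by (rule chart_inv_in_domain[OF assms])
  note F = linear_from_coords[OF assms(1) x]
  have "from_coords A c ?x u = 0 \<Longrightarrow> u = 0" for u
    using to_from_coords[OF assms(1) x, of u] linear_0[OF linear_to_coords[OF assms(1) x]] by simp
  then have pos: "u \<noteq> 0 \<Longrightarrow> g ?x (from_coords A c ?x u) (from_coords A c ?x u) > 0" for u
    using inner_product_pos[OF inner_product_metric[of ?x]] by blast
  then show ?thesis
    unfolding inner_product_def form_in_chart_def Let_def bilinear_def
    using linear_compose[OF F inner_product_linear(1)[OF inner_product_metric[of ?x]]]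
      linear_compose[OF F inner_product_linear(2)[OF inner_product_metric[of ?x]]]
      inner_product_commute[OF inner_product_metric[of ?x]] pos
    by (auto simp: o_def)
qed

lemma local_metric_form_in_chart: "c \<in> A \<Longrightarrow> local_metric (chart_image c) (form_in_chart A g c)"
  using open_image inner_product_form_in_chart smooth_metric
  by unfold_locales (auto simp: smooth_on_def)

end

context hyper_kaehler_manifold
begin

lemma hyper_hermitian_at: "hyper_hermitian (g x) (\<lambda>j. J j x)"
  by (rule hyper_hermitian.intro)
    (auto simp: inner_product_metric linear_J J_square J1_J2 J2_J1 hermitian)

lemma hyper_hermitian_in_chart:
  assumes "c \<in> A" "y \<in> chart_image c"
  shows "hyper_hermitian (form_in_chart A g c y) (\<lambda>j. endo_in_chart A (J j) c y)"
proof -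
  let ?x = "chart_inv c y"
  have x: "?x \<in> fst c" by (rule chart_inv_in_domain[OF assms])
  note F = linear_from_coords[OF assms(1) x] and T = linear_to_coords[OF assms(1) x]
  have "endo_in_chart A (J j) c y = to_coords A c ?x \<circ> (J j ?x \<circ> from_coords A c ?x)" for j
    by (rule ext) (simp add: endo_in_chart_def Let_def)
  then have "linear (endo_in_chart A (J j) c y)" for j
    using linear_compose[OF linear_compose[OF F linear_J] T] by simp
  then show ?thesis
    by (rule hyper_hermitian.intro[OF inner_product_form_in_chart[OF assms]])
      (simp_all add: endo_in_chart_def form_in_chart_def Let_def assms(1) x J_square J1_J2 J2_J1
        hermitian linear_neg[OF T])
qed

lemma local_hyper_kaehler_in_chart:
  assumes c: "c \<in> A"
  shows "local_hyper_kaehler (chart_image c) (form_in_chart A g c) (\<lambda>j. endo_in_chart A (J j) c)"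
proof -
  interpret local_metric "chart_image c" "form_in_chart A g c" by (rule local_metric_form_in_chart[OF c])
  show ?thesis
  proof (rule local_hyper_kaehler.intro[OF local_metric_axioms], rule local_hyper_kaehler_axioms.intro)
    show "C_k_on 2 (chart_image c) (\<lambda>y. endo_in_chart A (J j) c y u)" for j u
      using smooth_J[OF c] by (simp add: smooth_on_def)
    show "frechet_derivative (\<lambda>y. endo_in_chart A (J j) c y v) (at y) u
        + christoffel (form_in_chart A g c) y u (endo_in_chart A (J j) c y v)
      = endo_in_chart A (J j) c y (christoffel (form_in_chart A g c) y u v)"
      if "y \<in> chart_image c" for j y u v
      using parallel_J c that unfolding parallel_endo_def by blast
  qed (rule hyper_hermitian_in_chart[OF c])
qed

end

lemma smooth_map_prod_in_charts:
  fixes A :: "('m::{t2_space, second_countable_topology}, 'e::euclidean_space) chart set"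
    and B :: "('n::{t2_space, second_countable_topology}, 'f::euclidean_space) chart set"
    and C :: "('p::topological_space, 'g::real_normed_vector) chart set"
  assumes A: "smooth_manifold A" and B: "smooth_manifold B"
    and f: "smooth_map (prod_atlas A B) C f" and c: "c \<in> A" and d: "d \<in> B" and e: "e \<in> C" "open (fst e)"
  defines "W \<equiv> {(y, z). y \<in> chart_image c \<and> z \<in> chart_image d \<and> f (chart_inv c y, chart_inv d z) \<in> fst e}"
  shows "open W" "C_k_on k W (\<lambda>(y, z). snd e (f (chart_inv c y, chart_inv d z)))"
proof -
  interpret A: smooth_manifold A by (rule A)
  interpret B: smooth_manifold B by (rule B)
  let ?F = "\<lambda>p. (chart_inv c (fst p), chart_inv d (snd p))"
  let ?c = "(fst c \<times> fst d, map_prod (snd c) (snd d))"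
  have "continuous_on (chart_image c \<times> chart_image d) ?F"
    by (intro continuous_on_Pair continuous_on_compose2[OF A.continuous_on_chart_inv[OF c]]
        continuous_on_compose2[OF B.continuous_on_chart_inv[OF d]] continuous_intros) auto
  then have "continuous_on (chart_image c \<times> chart_image d) (f \<circ> ?F)"
    using f unfolding smooth_map_def by (intro continuous_on_compose) (auto elim: continuous_on_subset)
  then have "open (chart_image c \<times> chart_image d \<inter> (f \<circ> ?F) -` fst e)"
    using e A.open_image[OF c] B.open_image[OF d] by (intro continuous_open_preimage open_Times)
  moreover have "W = chart_image c \<times> chart_image d \<inter> (f \<circ> ?F) -` fst e"
    by (auto simp: W_def)
  ultimately show W: "open W" by simp
  \<comment> \<open>The inverse of a product chart is an \<open>inv_into\<close>, which does not
    split by definition; injectivity identifies it with the pair of inverses on the image.\<close>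
  have inv: "chart_inv ?c (y, z) = (chart_inv c y, chart_inv d z)"
    if "y \<in> chart_image c" "z \<in> chart_image d" for y z
  proof -
    have "inj_on (map_prod (snd c) (snd d)) (fst c \<times> fst d)"
      using c d by (auto simp: inj_on_def) (metis A.chart_inv_chart, metis B.chart_inv_chart)
    from inv_into_f_f[OF this, of "(chart_inv c y, chart_inv d z)"] show ?thesis
      using c d that by (simp add: chart_inv_def[of ?c] A.chart_inv_in_domain B.chart_inv_in_domain)
  qed
  have "?c \<in> prod_atlas A B" using c d unfolding prod_atlas_def by blast
  then have "smooth_on (snd ?c ` (fst ?c \<inter> f -` fst e)) (snd e \<circ> f \<circ> chart_inv ?c)"
    using f e by (auto simp: smooth_map_def)
  moreover have "snd ?c ` (fst ?c \<inter> f -` fst e) = W"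
  proof (intro subset_antisym subsetI)
    fix p assume "p \<in> snd ?c ` (fst ?c \<inter> f -` fst e)"
    then show "p \<in> W" using c d by (auto simp: W_def A.chart_in_image B.chart_in_image)
  next
    fix p assume "p \<in> W"
    then show "p \<in> snd ?c ` (fst ?c \<inter> f -` fst e)"
      using c d by (intro image_eqI[of _ _ "?F p"])
        (auto simp: W_def A.chart_inv_in_domain B.chart_inv_in_domain)
  qed
  ultimately have "C_k_on k W (snd e \<circ> f \<circ> chart_inv ?c)" by (simp add: smooth_on_def)
  then show "C_k_on k W (\<lambda>(y, z). snd e (f (chart_inv c y, chart_inv d z)))"
    by (rule C_k_on_cong[OF W, rotated]) (auto simp: W_def inv)
qed

section \<open>The action and its fundamental fields in charts\<close>

locale smooth_group_action = G: abelian_lie_group B + M: smooth_manifold A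
  for B :: "('t::{t2_space, second_countable_topology, ab_group_add}, 'f::euclidean_space) chart set"
    and A :: "('m::{t2_space, second_countable_topology}, 'e::euclidean_space) chart set" +
  fixes act :: "'t \<Rightarrow> 'm \<Rightarrow> 'm"
  assumes action: "smooth_action B A act"
begin

lemma act_0: "act 0 x = x" and act_add: "act (s + t) x = act s (act t x)"
  using action by (auto simp: smooth_action_def)

abbreviation "d\<^sub>0 \<equiv> chart_at B 0"
abbreviation "\<tau>\<^sub>0 \<equiv> snd d\<^sub>0 0"

text \<open>The domain of the action in group coordinates around 0 and the coordinates of
  \<open>c\<close>. Requiring that the moved point stays in \<open>c\<close> lets one chart serve as
  source and target.\<close>

definition flow_domain :: "('m, 'e) chart \<Rightarrow> ('f \<times> 'e) set" where
  "flow_domain c = {(\<tau>, y). \<tau> \<in> chart_image d\<^sub>0 \<and> y \<in> chart_image c \<and> act (chart_inv d\<^sub>0 \<tau>) (chart_inv c y) \<in> fst c}"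

definition flow :: "('m, 'e) chart \<Rightarrow> 'f \<times> 'e \<Rightarrow> 'e" where
  "flow c = (\<lambda>(\<tau>, y). snd c (act (chart_inv d\<^sub>0 \<tau>) (chart_inv c y)))"

lemma open_flow_domain: "c \<in> A \<Longrightarrow> open (flow_domain c)"
  and C_k_flow: "c \<in> A \<Longrightarrow> C_k_on k (flow_domain c) (flow c)"
proof -
  assume c: "c \<in> A"
  have "smooth_map (prod_atlas B A) A (\<lambda>(t, x). act t x)"
    using action by (simp add: smooth_action_def)
  note * = smooth_map_prod_in_charts[OF G.smooth_manifold_axioms M.smooth_manifold_axioms this
      G.chart_at(1)[of 0] c c M.open_domain[OF c]]
  show "open (flow_domain c)" using *(1) by (simp add: flow_domain_def)
  show "C_k_on k (flow_domain c) (flow c)" using *(2)[of k] by (simp add: flow_domain_def flow_def)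
qed

lemma flow_domain_0: "c \<in> A \<Longrightarrow> y \<in> chart_image c \<Longrightarrow> (\<tau>\<^sub>0, y) \<in> flow_domain c"
  using G.chart_at[of 0] by (simp add: flow_domain_def G.chart_in_image act_0 M.chart_inv_in_domain)

lemma open_slice: "c \<in> A \<Longrightarrow> open ((\<lambda>\<tau>. (\<tau>, y)) -` flow_domain c)"
  by (intro open_vimage open_flow_domain continuous_intros)

lemma has_derivative_flow:
  assumes "c \<in> A" "(\<tau>, y) \<in> flow_domain c"
  shows "((\<lambda>\<tau>. flow c (\<tau>, y)) has_derivative (\<lambda>v. frechet_derivative (flow c) (at (\<tau>, y)) (v, 0))) (at \<tau>)"
proof -
  have "((\<lambda>\<tau>. (\<tau>, y)) has_derivative (\<lambda>v. (v, 0))) (at \<tau>)"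
    by (intro has_derivative_Pair has_derivative_const has_derivative_ident)
  from diff_chain_at[OF this C_k_on_SucE[OF C_k_flow[OF assms(1)] assms(2)]] show ?thesis
    by (simp add: o_def)
qed

text \<open>\<open>fundamental_field\<close> is computed in the chart selected at each point, a
  selection with no regularity. In a fixed chart it becomes a partial derivative of the smooth map
  \<open>flow c\<close>, which yields its smoothness.\<close>

lemma fundamental_field_in_chart:
  assumes c: "c \<in> A" and y: "y \<in> chart_image c"
  shows "to_coords A c (chart_inv c y) (fundamental_field B A act v (chart_inv c y))
    = frechet_derivative (flow c) (at (\<tau>\<^sub>0, y)) (v, 0)"
proof -
  let ?x = "chart_inv c y" and ?D = "\<lambda>v. frechet_derivative (flow c) (at (\<tau>\<^sub>0, y)) (v, 0)"
  have x: "?x \<in> fst c" by (rule M.chart_inv_in_domain[OF c y])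
  have "(snd (chart_at A ?x) \<circ> chart_inv c has_derivative from_coords A c ?x) (at (flow c (\<tau>\<^sub>0, y)))"
    using M.has_derivative_from_coords[OF c x] G.chart_at[of 0] c y by (simp add: flow_def act_0)
  then have "(snd (chart_at A ?x) \<circ> (\<lambda>t. act t ?x) \<circ> chart_inv d\<^sub>0 has_derivative
      (\<lambda>v. from_coords A c ?x (?D v))) (at \<tau>\<^sub>0)"
    by (rule frechet_derivative_compose_near[OF _ has_derivative_flow[OF c flow_domain_0[OF c y]] open_slice[OF c]])
      (use c y flow_domain_0[OF c y] in \<open>auto simp: flow_domain_def flow_def\<close>)
  from frechet_derivative_eqI[OF this] show ?thesis
    unfolding fundamental_field_def differential_def act_0 using c x by simp
qed

lemma C_k_fundamental_field:
  assumes c: "c \<in> A"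
  shows "C_k_on k (chart_image c) (\<lambda>y. to_coords A c (chart_inv c y) (fundamental_field B A act v (chart_inv c y)))"
proof (rule C_k_on_cong[OF M.open_image[OF c]])
  have "C_k_on k (flow_domain c) (\<lambda>p. frechet_derivative (flow c) (at p) (v, 0))"
    using C_k_flow[OF c, of "Suc k"] by simp
  from C_k_on_slice[OF M.open_image[OF c] flow_domain_0[OF c] this]
  show "C_k_on k (chart_image c) (\<lambda>y. frechet_derivative (flow c) (at (\<tau>\<^sub>0, y)) (v, 0))" .
qed (rule fundamental_field_in_chart[OF c, symmetric])

text \<open>For \<sigma> near \<tau>, moving by the group element at \<sigma> is moving by the one
  at \<tau>, \<open>?t\<close>, and then by the difference. So the derivative at \<tau> factors
  through the derivative at \<open>\<tau>\<^sub>0\<close> of the orbit map of the moved point, which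
  is a vanishing fundamental field.\<close>

lemma has_derivative_flow_0:
  assumes V: "\<And>v x. fundamental_field B A act v x = 0" and c: "c \<in> A" and y: "y \<in> chart_image c"
    and \<tau>: "(\<tau>, y) \<in> flow_domain c"
  shows "((\<lambda>\<tau>. flow c (\<tau>, y)) has_derivative (\<lambda>_. 0)) (at \<tau>)"
proof -
  let ?t = "chart_inv d\<^sub>0 \<tau>" and ?x = "chart_inv c y"
  let ?x1 = "act ?t ?x" and ?d1 = "chart_at B (- chart_inv d\<^sub>0 \<tau>)"
  let ?y1 = "snd c ?x1"
  have x1: "?x1 \<in> fst c" and \<tau>': "\<tau> \<in> chart_image d\<^sub>0" using \<tau> by (auto simp: flow_domain_def)
  have y1: "?y1 \<in> chart_image c" by (rule M.chart_in_image[OF x1])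
  have 0: "((\<lambda>\<tau>. flow c (\<tau>, ?y1)) has_derivative (\<lambda>_. 0)) (at \<tau>\<^sub>0)"
    using has_derivative_flow[OF c flow_domain_0[OF c y1]]
    by (simp add: fundamental_field_in_chart[OF c y1, symmetric] V
        linear_0[OF M.linear_to_coords[OF c M.chart_inv_in_domain[OF c y1]]])
  \<comment> \<open>Group addition in coordinates. The second summand has a chart \<open>?d1\<close>
    of its own around \<open>- ?t\<close>, which may lie outside the domain of
    \<open>d\<^sub>0\<close>; freezing it at \<open>?z\<close> gives the translation by
    \<open>- ?t\<close>.\<close>
  let ?W = "{(\<tau>, z). \<tau> \<in> chart_image d\<^sub>0 \<and> z \<in> chart_image ?d1
      \<and> (case (chart_inv d\<^sub>0 \<tau>, chart_inv ?d1 z) of (s, t) \<Rightarrow> s + t) \<in> fst d\<^sub>0}"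
  let ?F = "\<lambda>(\<tau>, z). snd d\<^sub>0 (case (chart_inv d\<^sub>0 \<tau>, chart_inv ?d1 z) of (s, t) \<Rightarrow> s + t)"
  let ?z = "snd ?d1 (- ?t)"
  have z: "?z \<in> chart_image ?d1" "chart_inv ?d1 ?z = - ?t"
    using G.chart_at[of "- ?t"] by (auto simp: G.chart_in_image)
  have W: "open ?W" "C_k_on (Suc 0) ?W ?F"
    using smooth_map_prod_in_charts[OF G.smooth_manifold_axioms G.smooth_manifold_axioms G.smooth_add
        G.chart_at(1) G.chart_at(1) G.chart_at(1) G.open_domain[OF G.chart_at(1)]] by blast+
  have "(\<tau>, ?z) \<in> ?W" using z \<tau>' G.chart_at[of 0] by simp
  from C_k_on_SucE[OF W(2) this]
  have F: "(?F has_derivative frechet_derivative ?F (at (\<tau>, ?z))) (at (\<tau>, ?z))" .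
  have "((\<lambda>\<tau>. (\<tau>, ?z)) has_derivative (\<lambda>v. (v, 0))) (at \<tau>)"
    by (intro has_derivative_Pair has_derivative_const has_derivative_ident)
  from diff_chain_at[OF this F]
  have m: "((\<lambda>\<tau>. snd d\<^sub>0 (chart_inv d\<^sub>0 \<tau> + - ?t)) has_derivative
      (\<lambda>v. frechet_derivative ?F (at (\<tau>, ?z)) (v, 0))) (at \<tau>)"
    by (simp add: o_def z)
  show ?thesis
  proof (rule frechet_derivative_compose_near[OF _ m])
    show "((\<lambda>\<tau>. flow c (\<tau>, ?y1)) has_derivative (\<lambda>_. 0)) (at (snd d\<^sub>0 (chart_inv d\<^sub>0 \<tau> + - ?t)))"
      using 0 by simp
    show "open ((\<lambda>\<tau>. (\<tau>, ?z)) -` ?W)" by (intro open_vimage W continuous_intros)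
    show "\<tau> \<in> (\<lambda>\<tau>. (\<tau>, ?z)) -` ?W" using \<open>(\<tau>, ?z) \<in> ?W\<close> by blast
    fix \<sigma> assume "\<sigma> \<in> (\<lambda>\<tau>. (\<tau>, ?z)) -` ?W"
    then have "chart_inv d\<^sub>0 \<sigma> + - ?t \<in> fst d\<^sub>0" using z by simp
    then show "flow c (\<sigma>, y) = flow c (snd d\<^sub>0 (chart_inv d\<^sub>0 \<sigma> + - ?t), ?y1)"
      using c x1 G.chart_at[of 0] act_add[of "chart_inv d\<^sub>0 \<sigma> - ?t" ?t ?x] by (simp add: flow_def)
  qed
qed

lemma act_fixes_near_0:
  assumes V: "\<And>v x. fundamental_field B A act v x = 0"
  shows "\<exists>N. open N \<and> 0 \<in> N \<and> (\<forall>t\<in>N. act t x = x)"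
proof -
  let ?c = "chart_at A x"
  let ?y = "snd ?c x"
  have c: "?c \<in> A" "x \<in> fst ?c" and y: "?y \<in> chart_image ?c"
    using M.chart_at[of x] M.chart_in_image by simp_all
  have d: "d\<^sub>0 \<in> B" "0 \<in> fst d\<^sub>0" using G.chart_at[of 0] by auto
  obtain r where r: "r > 0" "ball \<tau>\<^sub>0 r \<subseteq> (\<lambda>\<tau>. (\<tau>, ?y)) -` flow_domain ?c"
    using open_slice[OF c(1), of ?y] flow_domain_0[OF c(1) y] open_contains_ball by blast
  have dom: "(\<tau>, ?y) \<in> flow_domain ?c" if "\<tau> \<in> ball \<tau>\<^sub>0 r" for \<tau>
    using subsetD[OF r(2) that] by (simp only: vimage_eq)
  have sub: "ball \<tau>\<^sub>0 r \<subseteq> chart_image d\<^sub>0"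
  proof
    fix \<tau> assume "\<tau> \<in> ball \<tau>\<^sub>0 r"
    from dom[OF this] show "\<tau> \<in> chart_image d\<^sub>0" by (simp add: flow_domain_def)
  qed
  have "act (chart_inv d\<^sub>0 \<tau>) x = x" if \<tau>: "\<tau> \<in> ball \<tau>\<^sub>0 r" for \<tau>
  proof -
    have "flow ?c (\<tau>, ?y) = flow ?c (\<tau>\<^sub>0, ?y)"
    proof (rule has_derivative_zero_unique[OF convex_ball _ \<tau>, of "\<lambda>\<tau>. flow ?c (\<tau>, ?y)"])
      show "((\<lambda>\<tau>. flow ?c (\<tau>, ?y)) has_derivative (\<lambda>_. 0)) (at \<sigma> within ball \<tau>\<^sub>0 r)"
        if "\<sigma> \<in> ball \<tau>\<^sub>0 r" for \<sigma>
        by (rule has_derivative_at_withinI[OF has_derivative_flow_0[OF V c(1) y dom[OF that]]])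
      show "\<tau>\<^sub>0 \<in> ball \<tau>\<^sub>0 r" using r(1) by simp
    qed
    then have "snd ?c (act (chart_inv d\<^sub>0 \<tau>) x) = snd ?c x"
      using c d by (simp add: flow_def act_0)
    moreover have "act (chart_inv d\<^sub>0 \<tau>) x \<in> fst ?c"
      using dom[OF \<tau>] c by (simp add: flow_domain_def)
    ultimately show ?thesis using c M.chart_inv_chart by metis
  qed
  moreover have "0 \<in> chart_inv d\<^sub>0 ` ball \<tau>\<^sub>0 r"
    using d r by (intro image_eqI[of _ _ \<tau>\<^sub>0]) auto
  ultimately show ?thesis
    using G.open_chart_inv_image[OF d(1) open_ball sub] by blast
qed

text \<open>The neighbourhood of 0 from \<open>act_fixes_near_0\<close> depends on the point that it
  fixes. Taken at \<open>act s x\<close> and translated by \<open>s\<close>, it shows that the orbit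
  map is locally constant, and the group is connected.\<close>

lemma trivial_if_fundamental_fields_0:
  assumes V: "\<And>v x. fundamental_field B A act v x = 0" and conn: "connected (UNIV :: 't set)"
  shows "act t x = x"
proof -
  have op: "open {t. P (act t x)}" for P
    unfolding open_subopen[of "{t. P (act t x)}"]
  proof (intro ballI)
    fix s assume s: "s \<in> {t. P (act t x)}"
    obtain N where N: "open N" "0 \<in> N" "\<forall>t\<in>N. act t (act s x) = act s x"
      using act_fixes_near_0[OF V, of "act s x"] by blast
    have "continuous_on UNIV (\<lambda>(s, t). s + t :: 't)"
      using G.smooth_add by (simp add: smooth_map_def)
    then have "continuous_on UNIV (\<lambda>t :: 't. case (t, - s) of (s, t) \<Rightarrow> s + t)"
      by (rule continuous_on_compose2) (auto intro!: continuous_intros)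
    then have "continuous_on UNIV (\<lambda>t. t + - s)" by simp
    then have "open ((\<lambda>t. t + - s) -` N)" by (rule open_vimage[OF N(1)])
    moreover have "P (act t x)" if "t + - s \<in> N" for t
      using N(3) that s act_add[of "t + - s" s x] by force
    ultimately show "\<exists>T. open T \<and> s \<in> T \<and> T \<subseteq> {t. P (act t x)}"
      using N(2) by (intro exI[of _ "(\<lambda>t. t + - s) -` N"]) auto
  qed
  have "{t. act t x = x} \<inter> UNIV = {} \<or> {t. act t x \<noteq> x} \<inter> UNIV = {}"
    by (rule connectedD[OF conn op[of "\<lambda>z. z = x"] op[of "\<lambda>z. z \<noteq> x"]]) auto
  moreover have "0 \<in> {t. act t x = x}" by (simp add: act_0)
  ultimately show ?thesis by blast
qed

end

section \<open>Conformality in terms of gradients\<close>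

lemma orthonormal_set_finite_card:
  fixes b :: "'f::euclidean_space \<Rightarrow> 'f \<Rightarrow> real"
  assumes b: "inner_product b" and E: "\<And>d e. d \<in> E \<Longrightarrow> e \<in> E \<Longrightarrow> b d e = (if d = e then 1 else 0)"
  shows "finite E" "card E \<le> DIM('f)"
  using independent_bound[OF orthogonal_independent[OF b _ E]] by auto

text \<open>Cardinalities of orthonormal sets are bounded by the dimension, so a largest one exists.
  It spans, since otherwise one Gram-Schmidt step would enlarge it.\<close>

lemma orthonormal_basis_exists:
  fixes b :: "'f::euclidean_space \<Rightarrow> 'f \<Rightarrow> real"
  assumes b: "inner_product b"
  shows "\<exists>E. orthonormal_basis b E"
proof -
  let ?Q = "\<lambda>E. \<forall>d\<in>E. \<forall>e\<in>E. b d e = (if d = e then 1 else 0)"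
  have fin: "finite E \<and> card E \<le> DIM('f)" if "?Q E" for E
    using orthonormal_set_finite_card[OF b, of E] that by auto
  have "\<exists>E. ?Q E \<and> (\<forall>E'. ?Q E' \<longrightarrow> card E' \<le> card E)"
    by (rule ex_has_greatest_nat[of ?Q "{}" card "Suc DIM('f)"]) (use fin in \<open>auto simp: less_Suc_eq_le\<close>)
  then obtain E where E: "?Q E" and max: "\<And>E'. ?Q E' \<Longrightarrow> card E' \<le> card E" by blast
  have "span E = UNIV"
  proof (rule ccontr)
    assume "span E \<noteq> UNIV"
    then obtain x where x: "x \<notin> span E" by blast
    define y where "y = x - (\<Sum>e\<in>E. b x e *\<^sub>R e)"
    have "(\<Sum>e\<in>E. b x e *\<^sub>R e) \<in> span E" by (intro span_sum span_scale span_base)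
    then have y: "y \<noteq> 0" using x by (auto simp: y_def)
    have ye: "b y e = 0" if "e \<in> E" for e
    proof -
      have "b (\<Sum>d\<in>E. b x d *\<^sub>R d) e = (\<Sum>d\<in>E. if d = e then b x e else 0)"
        unfolding linear_sum[OF inner_product_linear(2)[OF b]]
        using E that by (intro sum.cong) (auto simp: inner_product_simps[OF b])
      then show ?thesis using that fin[OF E] by (simp add: y_def inner_product_simps[OF b])
    qed
    define z where "z = (1 / sqrt (b y y)) *\<^sub>R y"
    have pos: "b y y > 0" by (rule inner_product_pos[OF b y])
    have zz: "b z z = 1"
      using pos by (simp add: z_def inner_product_simps[OF b] field_simps)
    have ze: "b z e = 0" "b e z = 0" if "e \<in> E" for e
      using ye[OF that] inner_product_commute[OF b, of e z]
      by (auto simp: z_def inner_product_simps[OF b])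
    have "z \<notin> E" using zz ze(1) by force
    moreover have "?Q (insert z E)" using E zz ze by auto
    ultimately show False using max[of "insert z E"] fin[OF E] by simp
  qed
  with E show ?thesis unfolding orthonormal_basis_def by blast
qed

lemma card_orthonormal_basis:
  fixes b :: "'f::euclidean_space \<Rightarrow> 'f \<Rightarrow> real"
  assumes b: "inner_product b" and E: "orthonormal_basis b E"
  shows "card E = DIM('f)"
proof -
  have "independent E"
    by (rule orthogonal_independent[OF b, of 1]) (use E in \<open>auto simp: orthonormal_basis_def\<close>)
  from dim_span_eq_card_independent[OF this] show ?thesis
    using E unfolding orthonormal_basis_def by (metis dim_UNIV)
qed

text \<open>If \<open>u\<close> is the horizontal vector that \<open>D\<close> maps to the form dual to \<open>e \<otimes> q\<^sub>i\<close>, conformality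
  identifies \<open>P e i\<close> with \<open>l\<^sup>2 *\<^sub>R u\<close>.\<close>

lemma conformal_gradients:
  fixes g :: "'e::euclidean_space \<Rightarrow> 'e \<Rightarrow> real" and b :: "'f::euclidean_space \<Rightarrow> 'f \<Rightarrow> real"
    and D :: "'e \<Rightarrow> 'f moment_space"
  assumes g: "inner_product g" and b: "inner_product b"
  defines "E \<equiv> SOME E. orthonormal_basis b E" and "H \<equiv> {u. \<forall>k. D k = 0 \<longrightarrow> g u k = 0}"
  assumes P: "\<And>e j u. e \<in> E \<Longrightarrow> blinfun_apply (blinfun_apply (D u) e) (axis j 1) = g (P e j) u"
    and conf: "(\<forall>u. D u = 0) \<or> (bij_betw D H UNIV \<and> (\<exists>l>0. \<forall>u\<in>H. \<forall>v\<in>H.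
      induced_inner_product b (D u) (D v) = l\<^sup>2 * g u v))"
  shows "\<exists>f. \<forall>e\<in>E. \<forall>e'\<in>E. \<forall>i j. g (P e i) (P e' j) = (if i = j \<and> e = e' then f else 0)"
  using conf
proof
  assume "\<forall>u. D u = 0"
  then have "P e j = 0" if "e \<in> E" for e j
    using P[OF that, of "P e j" j] inner_product_eq_0[OF g] by simp
  then show ?thesis by (intro exI[of _ 0]) (simp add: inner_product_simps[OF g])
next
  assume "bij_betw D H UNIV \<and> (\<exists>l>0. \<forall>u\<in>H. \<forall>v\<in>H.
      induced_inner_product b (D u) (D v) = l\<^sup>2 * g u v)"
  then obtain l where surj: "D ` H = UNIV" and l: "l > 0"
    and conf: "\<And>u v. u \<in> H \<Longrightarrow> v \<in> H \<Longrightarrow> induced_inner_product b (D u) (D v) = l\<^sup>2 * g u v"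
    by (auto simp: bij_betw_def)
  have E: "orthonormal_basis b E"
    unfolding E_def by (rule someI_ex[OF orthonormal_basis_exists[OF b]])
  have finE: "finite E"
    using orthonormal_set_finite_card(1)[OF b, of E] E by (auto simp: orthonormal_basis_def)
  have PH: "P e j \<in> H" if "e \<in> E" for e j
    using P[OF that, symmetric] by (simp add: H_def)
  have gP: "g (P e i) (P e' j) = (if i = j \<and> e = e' then l\<^sup>2 else 0)" if e: "e \<in> E" "e' \<in> E" for e e' i j
  proof -
    define \<beta> where "\<beta> = Blinfun (\<lambda>v. b e v *\<^sub>R blinfun_inner_right (axis i (1::real) :: real^3))"
    have "linear (\<lambda>v. b e v *\<^sub>R blinfun_inner_right (axis i (1::real) :: real^3))"
      by (rule linearI) (simp_all add: inner_product_simps[OF b] algebra_simps)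
    then have \<beta>: "blinfun_apply (blinfun_apply \<beta> v) q = b e v * (axis i 1 \<bullet> q)" for v q
      unfolding \<beta>_def
      by (simp add: bounded_linear_Blinfun_apply linear_conv_bounded_linear scaleR_blinfun.rep_eq)
    obtain u where u: "u \<in> H" "D u = \<beta>" using surj by (metis UNIV_I imageE)
    have "l\<^sup>2 * g u v = g (P e i) v" if "v \<in> H" for v
    proof -
      have "l\<^sup>2 * g u v = induced_inner_product b \<beta> (D v)" using conf[OF u(1) that] u(2) by simp
      also have "\<dots> = (\<Sum>d\<in>E. \<Sum>q\<in>Basis. (if d = e then if q = axis i 1 then
          blinfun_apply (blinfun_apply (D v) d) q else 0 else 0))"
        unfolding induced_inner_product_def E_def[symmetric]
        using E e(1) by (intro sum.cong refl) (auto simp: \<beta> orthonormal_basis_def inner_Basis axis_in_Basis_iff)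
      also have "\<dots> = (\<Sum>d\<in>E. (if d = e then blinfun_apply (blinfun_apply (D v) d) (axis i 1) else 0))"
        by (intro sum.cong refl) (auto simp: axis_in_Basis_iff)
      also have "\<dots> = g (P e i) v" using finE e(1) by (simp add: P)
      finally show ?thesis .
    qed
    \<comment> \<open>The product of \<open>P e' j\<close> with \<open>u\<close> is the value of
      \<open>D u\<close>, which is \<beta>, on \<open>e'\<close> and \<open>axis j 1\<close>; there
      \<beta> is a Kronecker delta. The common square is thus \<open>l\<^sup>2\<close>.\<close>
    from this[OF PH[OF e(2)]] have "g (P e i) (P e' j) = l\<^sup>2 * g (P e' j) u"
      using inner_product_commute[OF g] by metis
    also have "\<dots> = l\<^sup>2 * (b e e' * (axis i 1 \<bullet> (axis j 1 :: real^3)))"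
      using P[OF e(2), of u j] u(2) \<beta> by simp
    also have "\<dots> = (if i = j \<and> e = e' then l\<^sup>2 else 0)"
      using E e by (auto simp: orthonormal_basis_def inner_axis_axis)
    finally show ?thesis .
  qed
  then show ?thesis by blast
qed

lemma J_comb_axis: "J_comb J (axis j 1) x u = J j x u"
proof -
  have "J_comb J (axis j 1) x u = (\<Sum>i\<in>UNIV. if i = j then J j x u else 0)"
    unfolding J_comb_def by (intro sum.cong) (auto simp: axis_def)
  then show ?thesis by simp
qed

lemma bounded_linear_moment_component: "bounded_linear (\<lambda>\<alpha> :: 'f::euclidean_space moment_space. blinfun_apply (blinfun_apply \<alpha> v) q)"
  by (intro bounded_linear_compose[OF blinfun.bounded_linear_left] blinfun.bounded_linear_left)

theorem theorem3p7:
  fixes A :: "('m::{t2_space, second_countable_topology}, 'e::euclidean_space) chart set"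
    and g :: "'m \<Rightarrow> 'e \<Rightarrow> 'e \<Rightarrow> real"
    and J :: "3 \<Rightarrow> 'm \<Rightarrow> 'e \<Rightarrow> 'e"
    and B :: "('t::{t2_space, second_countable_topology, ab_group_add}, 'f::euclidean_space) chart set"
    and act :: "'t \<Rightarrow> 'm \<Rightarrow> 'm"
    and \<phi> :: "'m \<Rightarrow> 'f moment_space"
    and b :: "'f \<Rightarrow> 'f \<Rightarrow> real"
  assumes "hyper_kaehler_manifold A g J"
    and "connected (UNIV :: 'm set)"
    and "betti_number 1 (euclidean :: 'm topology) = 0"
    and "abelian_lie_group B"
    and "connected (UNIV :: 't set)"
    and "DIM('e) = 4 * DIM('f)"
    and "DIM('e) \<ge> 8"
    and "smooth_action B A act"
    and "nontrivial_action act"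
    and "\<And>t. riemannian_isometry A g (act t)"
    and "\<And>t. triholomorphic A J (act t)"
    and "hyper_kaehler_moment_map B A g J act \<phi>"
    and "inner_product b"
    and "horizontally_weakly_conformal A g vector_space_atlas (\<lambda>_. induced_inner_product b) \<phi>"
  shows "flat A g"
proof -
  interpret hyper_kaehler_manifold A g J by fact
  interpret act: smooth_group_action B A act
    using assms(4,8) smooth_manifold_axioms
    by (simp add: smooth_group_action_def smooth_group_action_axioms_def)
  define V where "V = fundamental_field B A act"
  define E where "E = (SOME E. orthonormal_basis b E)"
  have onb: "orthonormal_basis b E"
    unfolding E_def by (rule someI_ex[OF orthonormal_basis_exists[OF assms(13)]])
  have finE: "finite E"
    using orthonormal_set_finite_card(1)[OF assms(13), of E] onb by (auto simp: orthonormal_basis_def)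
  have cardE: "card E = DIM('f)" by (rule card_orthonormal_basis[OF assms(13) onb])
  have smooth_\<phi>: "smooth_map A vector_space_atlas \<phi>"
    using assms(12) by (simp add: hyper_kaehler_moment_map_def)
  define \<psi> where "\<psi> c v j y = blinfun_apply (blinfun_apply (\<phi> (chart_inv c y)) v) (axis j 1)" for c :: "('m, 'e) chart" and v j y
  let ?D = "differential A vector_space_atlas \<phi>"
  \<comment> \<open>The moment map equation for the unit \<open>axis j 1\<close>: the images of the
    fundamental fields under the complex structures are the gradients of the components of
    \<phi>.\<close>
  have D\<phi>: "blinfun_apply (blinfun_apply (?D x u) v) (axis j 1) = g x (J j x (V v x)) u" for x u v j
  proof -
    have "((\<lambda>x. blinfun_apply (blinfun_apply (\<phi> x) v) (axis j 1)) \<circ> chart_inv (chart_at A x) has_derivative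
        (\<lambda>u. blinfun_apply (blinfun_apply (?D x u) v) (axis j 1))) (at (snd (chart_at A x) x))"
      using bounded_linear.has_derivative[OF bounded_linear_moment_component
          has_derivative_differential[OF smooth_\<phi>]] by (simp add: o_def)
    from frechet_derivative_eqI[OF this]
    have "differential A vector_space_atlas (\<lambda>x. blinfun_apply (blinfun_apply (\<phi> x) v) (axis j 1)) x u
        = blinfun_apply (blinfun_apply (?D x u) v) (axis j 1)"
      by (simp add: differential_vector_space)
    moreover have "differential A vector_space_atlas (\<lambda>x. blinfun_apply (blinfun_apply (\<phi> x) v) (axis j 1)) x u
        = g x (J j x (V v x)) u"
      using assms(12) by (simp add: hyper_kaehler_moment_map_def kaehler_form_def J_comb_axis V_def)
    ultimately show ?thesis by simp
  qed
  \<comment> \<open>Linearity of the fundamental field in \<open>v\<close> is taken from the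
    differential of the moment map, which is linear in \<open>v\<close> by its type.\<close>
  have V_eq_0: "V v x = 0" if "\<And>e. e \<in> E \<Longrightarrow> V e x = 0" for v x
  proof -
    interpret H: hyper_hermitian "g x" "\<lambda>j. J j x" by (rule hyper_hermitian_at)
    have "g x (J 1 x (V v x)) (J 1 x (V v x)) = 0"
    proof -
      let ?u = "J 1 x (V v x)"
      have "linear (\<lambda>v. blinfun_apply (blinfun_apply (?D x ?u) v) (axis 1 1))"
        by (intro bounded_linear.linear bounded_linear_compose[OF blinfun.bounded_linear_left]
            blinfun.bounded_linear_right)
      moreover have "blinfun_apply (blinfun_apply (?D x ?u) e) (axis 1 1) = 0" if "e \<in> E" for e
        unfolding D\<phi> using \<open>\<And>e. e \<in> E \<Longrightarrow> V e x = 0\<close>[OF that] by (simp add: H.J_simps H.b_simps)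
      moreover have "v \<in> span E" using onb by (simp add: orthonormal_basis_def)
      ultimately have "blinfun_apply (blinfun_apply (?D x ?u) v) (axis 1 1) = 0"
        using linear_eq_0_on_span by blast
      then show ?thesis by (simp add: D\<phi>)
    qed
    then show ?thesis using inner_product_eq_0[OF H.ip] by (simp add: hermitian)
  qed
  have "\<exists>f. \<forall>e\<in>E. \<forall>e'\<in>E. \<forall>i j. g x (J i x (V e x)) (J j x (V e' x)) = (if i = j \<and> e = e' then f else 0)" for x
    unfolding E_def
    by (rule conformal_gradients[where D = "?D x"])
      (use assms(14) in \<open>auto simp: inner_product_metric assms(13) D\<phi> horizontally_weakly_conformal_def horizontal_space_def\<close>)
  \<comment> \<open>\<open>f\<close> is chosen separately at each point; its regularity follows only
    in charts.\<close>
  then obtain f where conf: "\<And>x e e' i j. e \<in> E \<Longrightarrow> e' \<in> E \<Longrightarrow>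
      g x (J i x (V e x)) (J j x (V e' x)) = (if i = j \<and> e = e' then f x else 0)"
    by metis
  \<comment> \<open>\<open>to_coords\<close> and \<open>from_coords\<close> cancel in all products,
    so the relations between the fields carry over to every chart.\<close>
  have loc: "local_conformal_moment (chart_image c) (form_in_chart A g c) (\<lambda>j. endo_in_chart A (J j) c) E
      (\<lambda>e y. to_coords A c (chart_inv c y) (V e (chart_inv c y))) (\<psi> c) (f \<circ> chart_inv c)"
    if c: "c \<in> A" for c
  proof (rule local_conformal_moment.intro[OF local_hyper_kaehler_in_chart[OF c]],
      rule local_conformal_moment_axioms.intro)
    show "finite E" by (rule finE)
    show "2 \<le> card E" "4 * card E = DIM('e)" using cardE assms(6,7) by auto
    show "C_k_on 2 (chart_image c) (\<lambda>y. to_coords A c (chart_inv c y) (V e (chart_inv c y)))" for e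
      unfolding V_def by (rule act.C_k_fundamental_field[OF c])
    have "C_k_on 2 (chart_image c) (\<phi> \<circ> chart_inv c)"
      using smooth_map_vector_space[OF smooth_\<phi> c] by (simp add: smooth_on_def)
    from C_k_on_bounded_linear[OF bounded_linear_moment_component open_image[OF c] this]
    show "C_k_on 2 (chart_image c) (\<psi> c e j)" for e j
      by (simp add: \<psi>_def[abs_def])
    fix y assume y: "y \<in> chart_image c"
    let ?x = "chart_inv c y"
    have x: "?x \<in> fst c" by (rule chart_inv_in_domain[OF c y])
    show "form_in_chart A g c y (endo_in_chart A (J j) c y (to_coords A c ?x (V e ?x))) v
        = frechet_derivative (\<psi> c e j) (at y) v" for e j v
    proof -
      have "(\<phi> \<circ> chart_inv c has_derivative (\<lambda>u. ?D ?x (from_coords A c ?x u))) (at y)"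
        using has_derivative_in_chart[OF c x has_derivative_differential[OF smooth_\<phi>]] c y by simp
      from bounded_linear.has_derivative[OF bounded_linear_moment_component this]
      have "(\<psi> c e j has_derivative (\<lambda>u. blinfun_apply (blinfun_apply (?D ?x (from_coords A c ?x u)) e) (axis j 1))) (at y)"
        by (simp add: \<psi>_def[abs_def])
      from frechet_derivative_eqI[OF this] show ?thesis
        using c x by (simp add: D\<phi> form_in_chart_def endo_in_chart_def Let_def)
    qed
    show "form_in_chart A g c y (endo_in_chart A (J i) c y (to_coords A c ?x (V e ?x)))
        (endo_in_chart A (J j) c y (to_coords A c ?x (V e' ?x)))
      = (if i = j \<and> e = e' then (f \<circ> chart_inv c) y else 0)" if "e \<in> E" "e' \<in> E" for e e' i j
      using c x conf[OF that] by (simp add: form_in_chart_def endo_in_chart_def Let_def)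
  qed
  have const: "f x = f x'" for x x'
    using local_conformal_moment.has_derivative_factor_0[OF loc]
    by (intro constant_if_chart_derivatives_0[OF assms(2)])
  obtain x\<^sub>0 where nontrivial: "range (\<lambda>t. act t x\<^sub>0) \<noteq> {x\<^sub>0}"
    using assms(9) unfolding nontrivial_action_def by blast
  have f: "f x\<^sub>0 \<noteq> 0"
  proof
    assume "f x\<^sub>0 = 0"
    then have "f x = 0" for x using const[of x x\<^sub>0] by simp
    then have "V e x = 0" if "e \<in> E" for e x
      using conf[OF that that, of x 1 1] inner_product_eq_0[OF inner_product_metric] by (simp add: hermitian)
    then have "V v x = 0" for v x using V_eq_0 by blast
    then have "act t x\<^sub>0 = x\<^sub>0" for t
      using act.trivial_if_fundamental_fields_0[OF _ assms(5)] unfolding V_def by blast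
    with nontrivial show False by auto
  qed
  show ?thesis
    unfolding flat_def
  proof (intro ballI allI)
    fix c y u v w assume "c \<in> A" "y \<in> chart_image c"
    then show "curvature (form_in_chart A g c) y u v w = 0"
      using local_conformal_moment.curvature_eq_0[OF loc _ f] const by auto
  qed
qed

end
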